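(* Let $X$ be a smooth manifold of dimension $d$, let $f\colon X\to X$ be a smooth map, and let $V\subset\mathcal{E}(X)$ be a quasi-Banach space such that the inclusion $\iota\colon V\hookrightarrow\mathcal{E}(X)$ is continuous. Let $p\in X$ be a periodic point of $f$ with $f^r(p)=p$ for some $r\ge 1$. Assume: (1) the composition operator $C_f$ is a bounded linear operator on $V$; and (2) for infinitely many $n\ge 0$, $\mathrm{Ker}(\kappa^n_p)\subset\mathrm{Ker}(\mathrm{gr}^n_{f_*^r})$. Then any (real or complex) eigenvalue $\alpha$ of $\mathrm{d}f^r_p\colon T_p(X)\to T_p(X)$ satisfies $|\alpha|\le 1$, where $T_p(X)$ is the tangent space of $X$ at $p$.
   Context: $\mathcal{E}(X)$ is the space of complex-valued $C^\infty$ functions on $X$ with the weak Whitney topology (uniform convergence of all derivatives on compact sets in local charts). For a topological vector space $W$, $W'$ is its dual with the strong topology, and for a continuous linear map $L\colon W_1\to W_2$, $L'\colon W_2'\to W_1'$ is the dual map. A quasi-Banach space is a complete Hausdorff complex topological vector space with a bounded neighborhood of $0$ (equivalently, complete with respect to a quasi-norm, i.e. a map $\|\cdot\|$ to $\mathbb{R}_{\ge 0}$ with $\|av\|=|a|\|v\|$, $\|v+w\|\le K(\|v\|+\|w\|)$ for some constant $K\ge1$, and $\|v\|=0\Rightarrow v=0$). The composition operator is $C_f h:=h\circ f$; "$C_f$ is a bounded linear operator on $V$" means that $h\circ f\in V$ for every $h\in V$ and that $C_f\colon V\to V$ is bounded (continuous). Let $\mathcal{D}(\mathbb{R}^d)=\bigoplus_{n_1,\dots,n_d\ge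 0}\mathbb{C}\,\partial_{x_1}^{n_1}\cdots\partial_{x_d}^{n_d}$, $\mathcal{D}_n(\mathbb{R}^d)=\bigoplus_{n_1+\dots+n_d\le n}\mathbb{C}\,\partial_{x_1}^{n_1}\cdots\partial_{x_d}^{n_d}$ for $n\ge0$. For $p\in X$ and a local coordinate $\phi$ from an open neighborhood of $p$ onto an open subset of $\mathbb{R}^d$, define the injective linear map $\delta_{p,\phi}\colon\mathcal{D}(\mathbb{R}^d)\to\mathcal{E}(X)'$ by $\delta_{p,\phi}(D)(h)=D(h\circ\phi^{-1})(\phi(p))$. Set $\mathcal{D}(X)_p=\delta_{p,\phi}(\mathcal{D}(\mathbb{R}^d))$, $\mathcal{D}_n(X)_p=\delta_{p,\phi}(\mathcal{D}_n(\mathbb{R}^d))$ (independent of $\phi$), and $\mathcal{D}_{-1}(X)_p=\{0\}$. Let $f^*\colon\mathcal{E}(X)\to\mathcal{E}(X)$, $h\mapsto h\circ f$, and $f_*:=(f^* )'\colon\mathcal{E}(X)'\to\mathcal{E}(X)'$. Since $f^r(p)=p$, the map $f_*^r=(f^r)_*$ preserves each $\mathcal{D}_n(X)_p$; $\mathrm{gr}^n_{f_*^r}$ denotes the induced linear map on $\mathcal{D}_n(X)_p/\mathcal{D}_{n-1}(X)_p$. For $n\ge0$, $\kappa^n_p\colon\mathcal{D}_n(X)_p/\mathcal{D}_{n-1}(X)_p\to\iota'(\mathcal{D}_n(X)_p)/\iota'(\mathcal{D}_{n-1}(X)_p)$ is the surjective linear map induced by $\iota'\colon\mathcal{E}(X)'\to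 V'$. *)

theory Defs
  imports
    "HOL-Analysis.Analysis"
    "HOL-Library.Poly_Mapping"
    "HOL-Library.Function_Algebras"
    "HOL-Library.Set_Algebras"
begin

subsection \<open>Smooth functions on open subsets of Euclidean space\<close>

text \<open>Only meant for open \<open>S\<close>. A function is \<open>C\<^sup>k\<^sup>+\<^sup>1\<close> if it is differentiable and all its
  directional derivatives are \<open>C\<^sup>k\<close>.\<close>

fun Ck_on :: "nat \<Rightarrow> 'a::real_normed_vector set \<Rightarrow> ('a \<Rightarrow> 'b::real_normed_vector) \<Rightarrow> bool" where
  "Ck_on 0 S g \<longleftrightarrow> continuous_on S g"
| "Ck_on (Suc k) S g \<longleftrightarrow>
     (\<forall>x\<in>S. g differentiable (at x)) \<and>
     (\<forall>v. Ck_on k S (\<lambda>x. frechet_derivative g (at x) v))"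

definition smooth_on :: "'a::real_normed_vector set \<Rightarrow> ('a \<Rightarrow> 'b::real_normed_vector) \<Rightarrow> bool" where
  "smooth_on S g \<longleftrightarrow> (\<forall>k. Ck_on k S g)"

subsection \<open>Smooth manifolds\<close>

text \<open>A manifold is modelled by a Hausdorff, second countable type \<open>'x\<close> together with a maximal
  smooth atlas; its dimension is \<open>CARD('d)\<close>. A chart is a pair \<open>(U, \<phi>)\<close>, where the values of
  \<open>\<phi>\<close> outside \<open>U\<close> are irrelevant.\<close>

type_synonym ('x, 'd) chart = "'x set \<times> ('x \<Rightarrow> real ^ 'd)"

abbreviation chart_inv :: "('x, 'd::finite) chart \<Rightarrow> real ^ 'd \<Rightarrow> 'x" where
  "chart_inv c \<equiv> inv_into (fst c) (snd c)"

definition is_chart :: "('x::topological_space, 'd::finite) chart \<Rightarrow> bool" where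
  "is_chart c \<longleftrightarrow> open (fst c) \<and> open (snd c ` fst c) \<and>
     homeomorphism (fst c) (snd c ` fst c) (snd c) (chart_inv c)"

definition compatible :: "('x, 'd::finite) chart \<Rightarrow> ('x, 'd) chart \<Rightarrow> bool" where
  "compatible c c' \<longleftrightarrow>
     smooth_on (snd c ` (fst c \<inter> fst c')) (snd c' \<circ> chart_inv c) \<and>
     smooth_on (snd c' ` (fst c \<inter> fst c')) (snd c \<circ> chart_inv c')"

definition smooth_structure ::
    "('x::{t2_space, second_countable_topology}, 'd::finite) chart set \<Rightarrow> bool" where
  "smooth_structure A \<longleftrightarrow>
     (\<forall>c\<in>A. is_chart c) \<and>
     (\<Union>c\<in>A. fst c) = UNIV \<and>
     (\<forall>c\<in>A. \<forall>c'\<in>A. compatible c c') \<and>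
     (\<forall>c. is_chart c \<and> (\<forall>c'\<in>A. compatible c c') \<longrightarrow> c \<in> A)"

definition charts_at :: "('x, 'd::finite) chart set \<Rightarrow> 'x \<Rightarrow> ('x, 'd) chart set" where
  "charts_at A p = {c \<in> A. p \<in> fst c}"

definition smooth_map ::
    "('x::topological_space, 'd::finite) chart set \<Rightarrow> ('x \<Rightarrow> 'x) \<Rightarrow> bool" where
  "smooth_map A f \<longleftrightarrow>
     continuous_on UNIV f \<and>
     (\<forall>c\<in>A. \<forall>c'\<in>A. smooth_on (snd c ` (fst c \<inter> f -` fst c')) (snd c' \<circ> f \<circ> chart_inv c))"

subsection \<open>Tangent spaces and differentials\<close>

text \<open>A tangent vector at \<open>p\<close> is given by its coordinate vectors \<open>v c\<close> with respect to all charts \<open>c\<close>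
  around \<open>p\<close>, which have to transform into each other by the derivatives of the coordinate changes.
  The value of \<open>v\<close> is \<open>0\<close> at the charts that do not contain \<open>p\<close>.\<close>

definition tangent_space ::
    "('x, 'd::finite) chart set \<Rightarrow> 'x \<Rightarrow> (('x, 'd) chart \<Rightarrow> real ^ 'd) set" where
  "tangent_space A p = {v.
     (\<forall>c. c \<notin> charts_at A p \<longrightarrow> v c = 0) \<and>
     (\<forall>c\<in>charts_at A p. \<forall>c'\<in>charts_at A p.
        v c' = frechet_derivative (snd c' \<circ> chart_inv c) (at (snd c p)) (v c))}"

text \<open>The map \<open>df\<^sub>p\<close> from the tangent space at \<open>p\<close> to the one at \<open>f p\<close>: the derivative of the
  coordinate expression of \<open>f\<close>. By the chain rule the result does not depend on the chart
  at \<open>p\<close> that is chosen.\<close>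

definition differential ::
    "('x, 'd::finite) chart set \<Rightarrow> ('x \<Rightarrow> 'x) \<Rightarrow> 'x \<Rightarrow>
     (('x, 'd) chart \<Rightarrow> real ^ 'd) \<Rightarrow> ('x, 'd) chart \<Rightarrow> real ^ 'd" where
  "differential A f p v = (\<lambda>c'.
     if c' \<in> charts_at A (f p)
     then let c = (SOME c. c \<in> charts_at A p)
          in frechet_derivative (snd c' \<circ> f \<circ> chart_inv c) (at (snd c p)) (v c)
     else 0)"

text \<open>Real or complex eigenvalues of a real-linear endomorphism \<open>L\<close> of \<open>T\<close>, that is, eigenvalues of
  its complexification: there is \<open>v + i w \<noteq> 0\<close> with \<open>L v + i L w = \<alpha> (v + i w)\<close>.\<close>

definition complex_eigenvalue ::
    "('c \<Rightarrow> 'e::real_vector) set \<Rightarrow> (('c \<Rightarrow> 'e) \<Rightarrow> 'c \<Rightarrow> 'e) \<Rightarrow> complex \<Rightarrow> bool" where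
  "complex_eigenvalue T L \<alpha> \<longleftrightarrow>
     (\<exists>v\<in>T. \<exists>w\<in>T. (v \<noteq> 0 \<or> w \<noteq> 0) \<and>
        L v = (\<lambda>c. Re \<alpha> *\<^sub>R v c - Im \<alpha> *\<^sub>R w c) \<and>
        L w = (\<lambda>c. Im \<alpha> *\<^sub>R v c + Re \<alpha> *\<^sub>R w c))"

subsection \<open>Differential operators with constant coefficients\<close>

text \<open>The space \<open>\<D>(\<real>\<^sup>d)\<close> is the type of finitely supported families of complex coefficients
  indexed by multi-indices.\<close>

type_synonym 'd diff_op = "('d \<Rightarrow> nat) \<Rightarrow>\<^sub>0 complex"

definition partial :: "'d::finite \<Rightarrow> (real ^ 'd \<Rightarrow> complex) \<Rightarrow> real ^ 'd \<Rightarrow> complex" where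
  "partial i g = (\<lambda>x. frechet_derivative g (at x) (axis i 1))"

text \<open>The order in which the coordinates are enumerated is irrelevant for smooth functions.\<close>

definition multi_partial :: "('d::finite \<Rightarrow> nat) \<Rightarrow> (real ^ 'd \<Rightarrow> complex) \<Rightarrow> real ^ 'd \<Rightarrow> complex" where
  "multi_partial m g =
     foldr (\<lambda>i. partial i ^^ m i) (SOME is. distinct is \<and> set is = (UNIV :: 'd set)) g"

definition apply_diff_op :: "'d::finite diff_op \<Rightarrow> (real ^ 'd \<Rightarrow> complex) \<Rightarrow> real ^ 'd \<Rightarrow> complex" where
  "apply_diff_op D g x = (\<Sum>m\<in>Poly_Mapping.keys D. Poly_Mapping.lookup D m * multi_partial m g x)"

text \<open>The order bound is an integer so that the operators of order at most \<open>-1\<close> make sense;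
  the only one is \<open>0\<close>.\<close>

definition diff_ops_upto :: "int \<Rightarrow> 'd::finite diff_op set" where
  "diff_ops_upto n = {D. \<forall>m\<in>Poly_Mapping.keys D. int (\<Sum>i\<in>UNIV. m i) \<le> n}"

subsection \<open>The space \<open>\<E>(X)\<close> and the functionals supported at a point\<close>

definition smooth_functions ::
    "('x, 'd::finite) chart set \<Rightarrow> ('x \<Rightarrow> complex) set" where
  "smooth_functions A = {h. \<forall>c\<in>A. smooth_on (snd c ` fst c) (h \<circ> chart_inv c)}"

text \<open>The weak Whitney topology, generated by the conditions that a given derivative in a given
  chart is uniformly close on a given compact set to that of a given smooth function.\<close>

definition whitney_topology ::
    "('x, 'd::finite) chart set \<Rightarrow> ('x \<Rightarrow> complex) topology" where
  "whitney_topology A = topology_generated_by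
     (insert (smooth_functions A)
       {{h \<in> smooth_functions A. \<forall>y\<in>K. cmod (multi_partial m ((h - g) \<circ> chart_inv c) y) < \<epsilon>}
        | g c K m \<epsilon>. g \<in> smooth_functions A \<and> c \<in> A \<and> compact K \<and> K \<subseteq> snd c ` fst c \<and> \<epsilon> > 0})"

text \<open>Linear functionals on a space \<open>W\<close> of functions are extended by \<open>0\<close> outside \<open>W\<close>, so that they
  are determined by their values on \<open>W\<close> and form a subspace of the space of all functions. The
  strong topology of the duals is not needed, since only kernels of linear maps between
  finite-dimensional spaces of functionals are considered below. For \<open>L\<close> from \<open>W\<^sub>1\<close> to \<open>W\<^sub>2\<close>,
  \<open>dual_map W\<^sub>1 L\<close> is the dual map \<open>L'\<close> from \<open>W\<^sub>2'\<close> to \<open>W\<^sub>1'\<close>.\<close>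

definition dual_map :: "'a set \<Rightarrow> ('a \<Rightarrow> 'b) \<Rightarrow> ('b \<Rightarrow> complex) \<Rightarrow> 'a \<Rightarrow> complex" where
  "dual_map W L u = (\<lambda>h. if h \<in> W then u (L h) else 0)"

definition pushforward ::
    "('x, 'd::finite) chart set \<Rightarrow> ('x \<Rightarrow> 'x) \<Rightarrow> (('x \<Rightarrow> complex) \<Rightarrow> complex) \<Rightarrow> ('x \<Rightarrow> complex) \<Rightarrow> complex"
  where "pushforward A f = dual_map (smooth_functions A) (\<lambda>h. h \<circ> f)"

abbreviation restriction ::
    "('x \<Rightarrow> complex) set \<Rightarrow> (('x \<Rightarrow> complex) \<Rightarrow> complex) \<Rightarrow> ('x \<Rightarrow> complex) \<Rightarrow> complex" where
  "restriction V \<equiv> dual_map V (\<lambda>h. h)"  \<comment> \<open>dual \<open>\<iota>'\<close> of the inclusion \<open>\<iota>\<close> of \<open>V\<close> into \<open>\<E>(X)\<close>\<close>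

definition delta ::
    "('x, 'd::finite) chart set \<Rightarrow> 'x \<Rightarrow> ('x, 'd) chart \<Rightarrow> 'd diff_op \<Rightarrow> ('x \<Rightarrow> complex) \<Rightarrow> complex" where
  "delta A p c D =
     (\<lambda>h. if h \<in> smooth_functions A then apply_diff_op D (h \<circ> chart_inv c) (snd c p) else 0)"

text \<open>The space \<open>\<D>\<^sub>n(X)\<^sub>p\<close>, computed in a chart \<open>c\<close> at \<open>p\<close>; it does not depend on \<open>c\<close>.\<close>

definition point_ops ::
    "('x, 'd::finite) chart set \<Rightarrow> 'x \<Rightarrow> ('x, 'd) chart \<Rightarrow> int \<Rightarrow> (('x \<Rightarrow> complex) \<Rightarrow> complex) set" where
  "point_ops A p c n = delta A p c ` diff_ops_upto n"

subsection \<open>Quotients and induced maps\<close>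

text \<open>Elements of a quotient space are cosets \<open>u +o B\<close>; the zero element of the quotient by \<open>B\<close>
  is \<open>B\<close> itself. For a linear map \<open>F\<close> sending \<open>B\<close> into \<open>B'\<close>, the induced map sends
  \<open>u +o B\<close> to \<open>F u +o B'\<close>, which is the union below.\<close>

definition quotient_space :: "'v::ab_group_add set \<Rightarrow> 'v set \<Rightarrow> 'v set set" where
  "quotient_space W B = (\<lambda>u. u +o B) ` W"

definition induced_map :: "('v \<Rightarrow> 'w::ab_group_add) \<Rightarrow> 'w set \<Rightarrow> 'v set \<Rightarrow> 'w set" where
  "induced_map F B' C = (\<Union>u\<in>C. F u +o B')"

definition gr_map ::
    "('x, 'd::finite) chart set \<Rightarrow> ('x \<Rightarrow> 'x) \<Rightarrow> 'x \<Rightarrow> ('x, 'd) chart \<Rightarrow> nat \<Rightarrow>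
     (('x \<Rightarrow> complex) \<Rightarrow> complex) set \<Rightarrow> (('x \<Rightarrow> complex) \<Rightarrow> complex) set" where
  "gr_map A f p c n = induced_map (pushforward A f) (point_ops A p c (int n - 1))"

definition ker_gr ::
    "('x, 'd::finite) chart set \<Rightarrow> ('x \<Rightarrow> 'x) \<Rightarrow> 'x \<Rightarrow> ('x, 'd) chart \<Rightarrow> nat \<Rightarrow>
     (('x \<Rightarrow> complex) \<Rightarrow> complex) set set" where
  "ker_gr A f p c n =
     {C \<in> quotient_space (point_ops A p c (int n)) (point_ops A p c (int n - 1)).
        gr_map A f p c n C = point_ops A p c (int n - 1)}"

definition kappa_map ::
    "('x, 'd::finite) chart set \<Rightarrow> ('x \<Rightarrow> complex) set \<Rightarrow> 'x \<Rightarrow> ('x, 'd) chart \<Rightarrow> nat \<Rightarrow>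
     (('x \<Rightarrow> complex) \<Rightarrow> complex) set \<Rightarrow> (('x \<Rightarrow> complex) \<Rightarrow> complex) set" where
  "kappa_map A V p c n =
     induced_map (restriction V) (restriction V ` point_ops A p c (int n - 1))"

definition ker_kappa ::
    "('x, 'd::finite) chart set \<Rightarrow> ('x \<Rightarrow> complex) set \<Rightarrow> 'x \<Rightarrow> ('x, 'd) chart \<Rightarrow> nat \<Rightarrow>
     (('x \<Rightarrow> complex) \<Rightarrow> complex) set set" where
  "ker_kappa A V p c n =
     {C \<in> quotient_space (point_ops A p c (int n)) (point_ops A p c (int n - 1)).
        kappa_map A V p c n C = restriction V ` point_ops A p c (int n - 1)}"

subsection \<open>Quasi-Banach spaces of functions\<close>

definition quasi_norm_on :: "('x \<Rightarrow> complex) set \<Rightarrow> (('x \<Rightarrow> complex) \<Rightarrow> real) \<Rightarrow> bool" where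
  "quasi_norm_on V N \<longleftrightarrow>
     (\<forall>v\<in>V. N v \<ge> 0) \<and>
     (\<forall>a. \<forall>v\<in>V. N (\<lambda>x. a * v x) = cmod a * N v) \<and>
     (\<exists>K\<ge>1. \<forall>v\<in>V. \<forall>w\<in>V. N (v + w) \<le> K * (N v + N w)) \<and>
     (\<forall>v\<in>V. N v = 0 \<longrightarrow> v = 0)"

definition quasi_banach_space :: "('x \<Rightarrow> complex) set \<Rightarrow> (('x \<Rightarrow> complex) \<Rightarrow> real) \<Rightarrow> bool" where
  "quasi_banach_space V N \<longleftrightarrow>
     0 \<in> V \<and> (\<forall>v\<in>V. \<forall>w\<in>V. v + w \<in> V) \<and> (\<forall>a. \<forall>v\<in>V. (\<lambda>x. a * v x) \<in> V) \<and>
     quasi_norm_on V N \<and>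
     (\<forall>s :: nat \<Rightarrow> 'x \<Rightarrow> complex. range s \<subseteq> V \<and>
        (\<forall>\<epsilon>>0. \<exists>M. \<forall>m\<ge>M. \<forall>n\<ge>M. N (s m - s n) < \<epsilon>) \<longrightarrow>
        (\<exists>v\<in>V. (\<lambda>n. N (s n - v)) \<longlonglongrightarrow> 0))"

text \<open>The balls of a quasi-norm need not be open, but they are neighbourhoods of their centres in
  this topology.\<close>

definition quasi_norm_topology ::
    "('x \<Rightarrow> complex) set \<Rightarrow> (('x \<Rightarrow> complex) \<Rightarrow> real) \<Rightarrow> ('x \<Rightarrow> complex) topology" where
  "quasi_norm_topology V N = topology (\<lambda>U.
     U \<subseteq> V \<and> (\<forall>v\<in>U. \<exists>\<epsilon>>0. \<forall>w\<in>V. N (w - v) < \<epsilon> \<longrightarrow> w \<in> U))"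

lemma openin_quasi_norm_topology:
  "openin (quasi_norm_topology V N) U \<longleftrightarrow>
     U \<subseteq> V \<and> (\<forall>v\<in>U. \<exists>\<epsilon>>0. \<forall>w\<in>V. N (w - v) < \<epsilon> \<longrightarrow> w \<in> U)"
proof -
  have "istopology (\<lambda>U. U \<subseteq> V \<and> (\<forall>v\<in>U. \<exists>\<epsilon>>0. \<forall>w\<in>V. N (w - v) < \<epsilon> \<longrightarrow> w \<in> U))"
    unfolding istopology_def
  proof (intro conjI allI impI)
    fix S T :: "('a \<Rightarrow> complex) set"
    assume S: "S \<subseteq> V \<and> (\<forall>v\<in>S. \<exists>\<epsilon>>0. \<forall>w\<in>V. N (w - v) < \<epsilon> \<longrightarrow> w \<in> S)"
      and T: "T \<subseteq> V \<and> (\<forall>v\<in>T. \<exists>\<epsilon>>0. \<forall>w\<in>V. N (w - v) < \<epsilon> \<longrightarrow> w \<in> T)"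
    show "S \<inter> T \<subseteq> V" using S by blast
    show "\<forall>v\<in>S \<inter> T. \<exists>\<epsilon>>0. \<forall>w\<in>V. N (w - v) < \<epsilon> \<longrightarrow> w \<in> S \<inter> T"
    proof
      fix v assume "v \<in> S \<inter> T"
      then obtain a b where "a > 0" "\<forall>w\<in>V. N (w - v) < a \<longrightarrow> w \<in> S"
        and "b > 0" "\<forall>w\<in>V. N (w - v) < b \<longrightarrow> w \<in> T"
        using S T by blast
      then show "\<exists>\<epsilon>>0. \<forall>w\<in>V. N (w - v) < \<epsilon> \<longrightarrow> w \<in> S \<inter> T"
        by (intro exI[of _ "min a b"]) auto
    qed
  next
    fix \<K> :: "('a \<Rightarrow> complex) set set"
    assume K: "\<forall>S\<in>\<K>. S \<subseteq> V \<and> (\<forall>v\<in>S. \<exists>\<epsilon>>0. \<forall>w\<in>V. N (w - v) < \<epsilon> \<longrightarrow> w \<in> S)"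
    show "\<Union>\<K> \<subseteq> V" using K by blast
    show "\<forall>v\<in>\<Union>\<K>. \<exists>\<epsilon>>0. \<forall>w\<in>V. N (w - v) < \<epsilon> \<longrightarrow> w \<in> \<Union>\<K>" using K by (meson UnionE UnionI)
  qed
  then show ?thesis
    unfolding quasi_norm_topology_def by (simp add: topology_inverse')
qed

definition bounded_composition_operator ::
    "('x \<Rightarrow> 'x) \<Rightarrow> ('x \<Rightarrow> complex) set \<Rightarrow> (('x \<Rightarrow> complex) \<Rightarrow> real) \<Rightarrow> bool" where
  "bounded_composition_operator f V N \<longleftrightarrow>
     (\<forall>h\<in>V. h \<circ> f \<in> V) \<and> (\<exists>C. \<forall>h\<in>V. N (h \<circ> f) \<le> C * N h)"

end

theory Submission
  imports Defs
begin

text \<open>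
  Suppose \<open>|\<alpha>| > 1\<close> and put \<open>g = f\<^sup>r\<close>. By linear duality, the functionals of order at most \<open>n\<close> at \<open>p\<close>
  are exactly the linear functionals that annihilate all functions vanishing to order \<open>n + 1\<close> at \<open>p\<close>,
  and this condition is stable under composition with \<open>g\<close>. For an eigenvector \<open>z\<close> of the
  complexified differential, let \<open>u\<close> be the \<open>n\<close>-fold derivative at \<open>p\<close> in the direction \<open>z\<close>. If \<open>h\<close>
  vanishes to order \<open>n\<close>, then \<open>u (h \<circ> g) = \<alpha>\<^sup>n u h\<close>; a bump function shows that \<open>g\<^sub>* u\<close> has order exactly
  \<open>n\<close>, so for the admissible \<open>n\<close> the class of \<open>u\<close> is not in the kernel of \<open>\<kappa>\<^sup>n\<close>. By duality again there
  is an \<open>h \<in> V\<close> vanishing to order \<open>n\<close> with \<open>u h \<noteq> 0\<close>. As \<open>u\<close> is bounded on \<open>V\<close>, iterating gives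
  \<open>|\<alpha>|\<^sup>n\<^sup>m |u h| = |u (h \<circ> g\<^sup>m)| \<le> B C\<^sup>r\<^sup>m \<parallel>h\<parallel>\<close> for all \<open>m\<close>, that is \<open>|\<alpha>|\<^sup>n \<le> C\<^sup>r\<close>, which fails for large \<open>n\<close>.
\<close>

subsection \<open>Calculus of \<open>C\<^sup>k\<close> functions\<close>

text \<open>A higher chain rule for \<open>h \<circ> g\<close> would produce many lower-order terms.
  Testing \<open>u\<close> only on functions vanishing to order n removes them: at p only the first
  derivative of g then contributes. So membership in a space of functionals is tested by
  annihilation, not by coefficients. The same finite-dimensional duality is used on two spaces. On
  all smooth functions it characterises the functionals of order below n. On V it turns
  "\<open>u\<close> kills every function of V vanishing to order n" into a lower-order functional
  that agrees with \<open>u\<close> on V, and this puts the class of \<open>u\<close> in the kernel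
  of \<open>ker_kappa\<close>. The bound C for composition with f is fixed before n. Infinitely many
  admissible orders allow n to be chosen afterwards, so large that the growth rate of
  \<open>u\<close> beats C. Operators are written with multi-indices in one fixed enumeration of the
  coordinates, while all estimates are inductions over single partial derivatives. Symmetry of
  second derivatives links the two.\<close>

lemma Ck_on_subset: "Ck_on k S f \<Longrightarrow> T \<subseteq> S \<Longrightarrow> Ck_on k T f"
  by (induction k arbitrary: f) (auto intro: continuous_on_subset)

text \<open>Openness of \<open>S\<close> matters: \<open>Ck_on\<close> differentiates in the whole
  space, so agreement is required on a full neighbourhood of each point.\<close>

lemma Ck_on_cong:
  assumes "open S" "\<And>x. x \<in> S \<Longrightarrow> f x = g x" "Ck_on k S f"
  shows "Ck_on k S g"
  using assms(2,3)
proof (induction k arbitrary: f g)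
  case 0
  then show ?case by (simp cong: continuous_on_cong)
next
  case (Suc k)
  have fr: "frechet_derivative f (at x) = frechet_derivative g (at x)" if "x \<in> S" for x
    by (rule frechet_derivative_transform_within_open[of _ _ S])
       (use Suc.prems that \<open>open S\<close> in auto)
  have "g differentiable (at x)" if "x \<in> S" for x
  proof -
    have "(f has_derivative frechet_derivative f (at x)) (at x)"
      using Suc.prems that by (simp add: frechet_derivative_works)
    then have "(g has_derivative frechet_derivative f (at x)) (at x)"
      by (rule has_derivative_transform_within_open[of _ _ _ _ S]) (use Suc.prems that \<open>open S\<close> in auto)
    then show ?thesis by (rule differentiableI)
  qed
  moreover have "Ck_on k S (\<lambda>x. frechet_derivative g (at x) v)" for v
    by (rule Suc.IH[of "\<lambda>x. frechet_derivative f (at x) v"]) (use Suc.prems fr in auto)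
  ultimately show ?case by simp
qed

lemma Ck_on_imp_continuous_on: "Ck_on k S f \<Longrightarrow> continuous_on S f"
  by (cases k)
     (auto intro!: continuous_at_imp_continuous_on differentiable_imp_continuous_within)

lemma Ck_on_SucD: "Ck_on (Suc k) S f \<Longrightarrow> Ck_on k S f"
proof (induction k arbitrary: f)
  case 0
  then show ?case by (metis Ck_on.simps(1) Ck_on_imp_continuous_on)
next
  case (Suc k)
  then show ?case by (metis Ck_on.simps(2))
qed

text \<open>Lets the usual derivative rules supply a formula \<open>f'\<close>; uniqueness of the
  derivative identifies it with \<open>frechet_derivative\<close>.\<close>

lemma Ck_on_SucI:
  assumes "open S" "\<And>x. x \<in> S \<Longrightarrow> (f has_derivative f' x) (at x)"
    "\<And>v. Ck_on k S (\<lambda>x. f' x v)"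
  shows "Ck_on (Suc k) S f"
proof -
  have "frechet_derivative f (at x) = f' x" if "x \<in> S" for x
    using assms(2)[OF that] frechet_derivative_at by metis
  then have "Ck_on k S (\<lambda>x. frechet_derivative f (at x) v)" for v
    by (intro Ck_on_cong[OF \<open>open S\<close> _ assms(3)]) auto
  then show ?thesis using assms(2) by (auto intro: differentiableI)
qed

lemma Ck_on_Suc_has_derivative:
  "Ck_on (Suc k) S f \<Longrightarrow> x \<in> S \<Longrightarrow> (f has_derivative frechet_derivative f (at x)) (at x)"
  by (simp add: frechet_derivative_works)

text \<open>On a manifold the auxiliary chart changes from point to point, so smoothness is first
  obtained near each point. Both clauses of \<open>Ck_on\<close> only concern neighbourhoods of
  single points, hence they glue.\<close>

lemma Ck_on_local:
  assumes "\<And>x. x \<in> S \<Longrightarrow> \<exists>T. open T \<and> x \<in> T \<and> Ck_on k T f"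
  shows "Ck_on k S f"
  using assms
proof (induction k arbitrary: f)
  case 0
  have "continuous (at x) f" if "x \<in> S" for x
    using 0[OF that] by (auto simp: continuous_on_eq_continuous_at)
  then show ?case by (simp add: continuous_at_imp_continuous_on)
next
  case (Suc k)
  have "f differentiable at x" if "x \<in> S" for x
    using Suc.prems[OF that] by auto
  moreover have "Ck_on k S (\<lambda>x. frechet_derivative f (at x) v)" for v
    by (rule Suc.IH) (use Suc.prems in fastforce)
  ultimately show ?case by simp
qed

lemma Ck_on_const: "Ck_on k S (\<lambda>x. c)"
  by (induction k arbitrary: c) auto

lemma Ck_on_bounded_linear_compose:
  assumes "open S" "bounded_linear L" "Ck_on k S f"
  shows "Ck_on k S (\<lambda>x. L (f x))"
  using assms(3)
proof (induction k arbitrary: f)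
  case 0
  then show ?case
    using bounded_linear.continuous_on[OF assms(2)] by auto
next
  case (Suc k)
  show ?case
    by (rule Ck_on_SucI[OF \<open>open S\<close>
          bounded_linear.has_derivative[OF assms(2) Ck_on_Suc_has_derivative[OF Suc.prems]]])
       (use Suc in auto)
qed

lemma Ck_on_bounded_linear:
  assumes "open S" "bounded_linear L"
  shows "Ck_on k S L"
proof (cases k)
  case 0
  then show ?thesis
    using linear_continuous_on[OF assms(2)] by simp
next
  case (Suc k)
  show ?thesis unfolding Suc
    by (rule Ck_on_SucI[OF \<open>open S\<close> bounded_linear_imp_has_derivative[OF assms(2)]])
       (rule Ck_on_const)
qed

lemma Ck_on_add:
  assumes "open S" "Ck_on k S f" "Ck_on k S g"
  shows "Ck_on k S (\<lambda>x. f x + g x)"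
  using assms(2,3)
proof (induction k arbitrary: f g)
  case 0
  then show ?case by (auto intro: continuous_on_add)
next
  case (Suc k)
  show ?case
    by (rule Ck_on_SucI[OF \<open>open S\<close>
          has_derivative_add[OF Suc.prems[THEN Ck_on_Suc_has_derivative]]])
       (use Suc in auto)
qed

lemma Ck_on_sum:
  assumes "open S" "\<And>i. i \<in> I \<Longrightarrow> Ck_on k S (f i)"
  shows "Ck_on k S (\<lambda>x. \<Sum>i\<in>I. f i x)"
  using assms(2)
  by (induction I rule: infinite_finite_induct) (auto intro!: Ck_on_const Ck_on_add assms(1))

lemma Ck_on_bilinear:
  assumes "open S" "bounded_bilinear prd" "Ck_on k S f" "Ck_on k S g"
  shows "Ck_on k S (\<lambda>x. prd (f x) (g x))"
  using assms(3,4)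
proof (induction k arbitrary: f g)
  case 0
  then show ?case using bounded_bilinear.continuous_on[OF assms(2)] by auto
next
  case (Suc k)
  show ?case
    by (rule Ck_on_SucI[OF \<open>open S\<close>
          bounded_bilinear.FDERIV[OF assms(2) Suc.prems[THEN Ck_on_Suc_has_derivative]]])
       (use Suc.prems in \<open>auto intro!: Ck_on_add \<open>open S\<close> Suc.IH
          intro: Ck_on_SucD[OF Suc.prems(1)] Ck_on_SucD[OF Suc.prems(2)]\<close>)
qed

lemma linear_euclidean_expansion:
  fixes L :: "'a::euclidean_space \<Rightarrow> 'b::real_vector"
  assumes "linear L"
  shows "L v = (\<Sum>b\<in>Basis. (v \<bullet> b) *\<^sub>R L b)"
  by (metis (no_types, lifting) assms euclidean_representation linear.scaleR linear_sum sum.cong)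

text \<open>In the chain rule the derivative of \<open>g\<close> is applied to a direction that
  varies with \<open>x\<close>, while the induction hypothesis speaks of fixed directions. Expanding
  that direction in the basis of the middle space separates the two, which is why this space is
  Euclidean.\<close>

lemma Ck_on_compose:
  fixes f :: "'a::real_normed_vector \<Rightarrow> 'b::euclidean_space"
    and g :: "'b \<Rightarrow> 'c::real_normed_vector"
  assumes "open S" "open T" "f ` S \<subseteq> T" "Ck_on k S f" "Ck_on k T g"
  shows "Ck_on k S (\<lambda>x. g (f x))"
  using assms(4,5)
proof (induction k arbitrary: g)
  case 0
  then show ?case using assms(3) by (auto intro: continuous_on_compose2)
next
  case (Suc k)
  have fT: "f x \<in> T" if "x \<in> S" for x using assms(3) that by auto
  have der: "((\<lambda>x. g (f x)) has_derivative
      (\<lambda>v. \<Sum>b\<in>Basis. (frechet_derivative f (at x) v \<bullet> b) *\<^sub>R frechet_derivative g (at (f x)) b)) (at x)"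
    if "x \<in> S" for x
  proof -
    have g: "(g has_derivative frechet_derivative g (at (f x))) (at (f x))"
      using Ck_on_Suc_has_derivative[OF Suc.prems(2) fT[OF that]] .
    have lin: "linear (frechet_derivative g (at (f x)))"
      by (rule has_derivative_linear[OF g])
    show ?thesis
      using has_derivative_compose[OF Ck_on_Suc_has_derivative[OF Suc.prems(1) that] g]
      by (simp add: linear_euclidean_expansion[OF lin, symmetric])
  qed
  show ?case
  proof (rule Ck_on_SucI[OF \<open>open S\<close> der])
    fix v
    show "Ck_on k S (\<lambda>x. \<Sum>b\<in>Basis. (frechet_derivative f (at x) v \<bullet> b) *\<^sub>R
        frechet_derivative g (at (f x)) b)"
    proof (intro Ck_on_sum Ck_on_bilinear[OF \<open>open S\<close> bounded_bilinear_scaleR] \<open>open S\<close>)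
      fix b :: 'b
      show "Ck_on k S (\<lambda>x. frechet_derivative f (at x) v \<bullet> b)"
        using Suc.prems(1)
        by (intro Ck_on_bounded_linear_compose[OF \<open>open S\<close> bounded_linear_inner_left]) auto
      show "Ck_on k S (\<lambda>x. frechet_derivative g (at (f x)) b)"
        by (rule Suc.IH) (use Suc.prems Ck_on_SucD in auto)
    qed
  qed auto
qed

section \<open>Smooth functions: the rules for all k at once\<close>

lemma smooth_on_subset: "smooth_on S f \<Longrightarrow> T \<subseteq> S \<Longrightarrow> smooth_on T f"
  unfolding smooth_on_def using Ck_on_subset by blast

lemma smooth_on_cong:
  "open S \<Longrightarrow> (\<And>x. x \<in> S \<Longrightarrow> f x = g x) \<Longrightarrow> smooth_on S f \<Longrightarrow> smooth_on S g"
  unfolding smooth_on_def using Ck_on_cong by blast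

lemma smooth_on_local:
  assumes "\<And>x. x \<in> S \<Longrightarrow> \<exists>T. open T \<and> x \<in> T \<and> smooth_on T f"
  shows "smooth_on S f"
  unfolding smooth_on_def
  by (intro allI Ck_on_local) (use assms in \<open>auto simp: smooth_on_def\<close>)

lemma smooth_on_const: "smooth_on S (\<lambda>x. c)"
  by (simp add: smooth_on_def Ck_on_const)

lemma smooth_on_add:
  "open S \<Longrightarrow> smooth_on S f \<Longrightarrow> smooth_on S g \<Longrightarrow> smooth_on S (\<lambda>x. f x + g x)"
  by (simp add: smooth_on_def Ck_on_add)

lemma smooth_on_sum:
  "open S \<Longrightarrow> (\<And>i. i \<in> I \<Longrightarrow> smooth_on S (f i)) \<Longrightarrow> smooth_on S (\<lambda>x. \<Sum>i\<in>I. f i x)"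
  by (simp add: smooth_on_def Ck_on_sum)

lemma smooth_on_mult:
  fixes f g :: "'a::real_normed_vector \<Rightarrow> 'b::real_normed_algebra"
  shows "open S \<Longrightarrow> smooth_on S f \<Longrightarrow> smooth_on S g \<Longrightarrow> smooth_on S (\<lambda>x. f x * g x)"
  by (simp add: smooth_on_def Ck_on_bilinear[OF _ bounded_bilinear_mult])

lemma smooth_on_cmult:
  fixes f :: "'a::real_normed_vector \<Rightarrow> 'b::real_normed_algebra"
  shows "open S \<Longrightarrow> smooth_on S f \<Longrightarrow> smooth_on S (\<lambda>x. c * f x)"
  by (intro smooth_on_mult smooth_on_const)

lemma smooth_on_power:
  fixes f :: "'a::real_normed_vector \<Rightarrow> 'b::real_normed_algebra_1"
  shows "open S \<Longrightarrow> smooth_on S f \<Longrightarrow> smooth_on S (\<lambda>x. f x ^ n)"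
  by (induction n) (auto intro: smooth_on_mult smooth_on_const)

lemma smooth_on_bounded_linear_compose:
  "open S \<Longrightarrow> bounded_linear L \<Longrightarrow> smooth_on S f \<Longrightarrow> smooth_on S (\<lambda>x. L (f x))"
  by (simp add: smooth_on_def Ck_on_bounded_linear_compose)

lemma smooth_on_bounded_linear:
  "open S \<Longrightarrow> bounded_linear L \<Longrightarrow> smooth_on S L"
  by (simp add: smooth_on_def Ck_on_bounded_linear)

lemma smooth_on_compose:
  fixes f :: "'a::real_normed_vector \<Rightarrow> 'b::euclidean_space"
  shows "open S \<Longrightarrow> open T \<Longrightarrow> f ` S \<subseteq> T \<Longrightarrow> smooth_on S f \<Longrightarrow> smooth_on T g \<Longrightarrow>
    smooth_on S (\<lambda>x. g (f x))"
  by (simp add: smooth_on_def Ck_on_compose)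

lemma smooth_on_has_derivative:
  "smooth_on S f \<Longrightarrow> x \<in> S \<Longrightarrow> (f has_derivative frechet_derivative f (at x)) (at x)"
  unfolding smooth_on_def using Ck_on_Suc_has_derivative by blast

lemma smooth_on_frechet_derivative:
  "smooth_on S f \<Longrightarrow> smooth_on S (\<lambda>x. frechet_derivative f (at x) v)"
  unfolding smooth_on_def by (metis Ck_on.simps(2))

lemma smooth_on_imp_continuous_on: "smooth_on S f \<Longrightarrow> continuous_on S f"
  unfolding smooth_on_def using Ck_on_imp_continuous_on by blast

subsection \<open>Symmetry of second derivatives\<close>

lemma has_real_derivative_line:
  fixes f :: "'a::real_normed_vector \<Rightarrow> real"
  assumes "(f has_derivative f') (at (a + s *\<^sub>R u))"
  shows "((\<lambda>s. f (a + s *\<^sub>R u)) has_real_derivative f' u) (at s)"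
proof -
  have 1: "((\<lambda>s. a + s *\<^sub>R u) has_derivative (\<lambda>s. s *\<^sub>R u)) (at s)"
    by (auto intro!: derivative_eq_intros)
  have "((\<lambda>s. f (a + s *\<^sub>R u)) has_derivative (\<lambda>s. f' (s *\<^sub>R u))) (at s)"
    by (rule has_derivative_compose[OF 1 assms])
  moreover have "f' (s *\<^sub>R u) = f' u * s" for s
    using linear_cmul[OF has_derivative_linear[OF assms]] by simp
  ultimately show ?thesis by (simp add: has_field_derivative_def)
qed

text \<open>Two applications of the mean value theorem: the increment in direction \<open>v\<close>
  is a function of the step in direction \<open>u\<close>, and the resulting difference of
  \<open>u\<close>-derivatives is then treated in direction \<open>v\<close>. The left-hand side is
  symmetric in \<open>u\<close> and \<open>v\<close>, the right-hand side is not.\<close>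

lemma second_difference_mean_value:
  fixes f :: "'a::real_normed_vector \<Rightarrow> real"
  assumes f: "\<And>y. y \<in> ball x \<delta> \<Longrightarrow> f differentiable (at y)"
    and fu: "\<And>y. y \<in> ball x \<delta> \<Longrightarrow> (\<lambda>y. frechet_derivative f (at y) u) differentiable (at y)"
    and t: "t > 0" "t * (norm u + norm v) < \<delta>"
  shows "\<exists>y\<in>ball x \<delta>. f (x + t *\<^sub>R u + t *\<^sub>R v) - f (x + t *\<^sub>R u) - f (x + t *\<^sub>R v) + f x =
    t * t * frechet_derivative (\<lambda>y. frechet_derivative f (at y) u) (at y) v"
proof -
  have in_ball: "x + s *\<^sub>R u + s' *\<^sub>R v \<in> ball x \<delta>" if "0 \<le> s" "s \<le> t" "0 \<le> s'" "s' \<le> t" for s s'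
  proof -
    have "norm (s *\<^sub>R u + s' *\<^sub>R v) \<le> s * norm u + s' * norm v"
      using norm_triangle_ineq[of "s *\<^sub>R u" "s' *\<^sub>R v"] that by simp
    also have "\<dots> \<le> t * norm u + t * norm v"
      using that by (intro add_mono mult_right_mono) auto
    also have "\<dots> < \<delta>" using t by (simp add: distrib_left)
    finally have "dist (x + (s *\<^sub>R u + s' *\<^sub>R v)) x < \<delta>"
      by (simp only: dist_norm add_diff_cancel_left')
    then show ?thesis by (metis add.assoc dist_commute mem_ball)
  qed
  let ?\<phi> = "\<lambda>s. f (x + t *\<^sub>R v + s *\<^sub>R u) - f (x + s *\<^sub>R u)"
  let ?Du = "\<lambda>y. frechet_derivative f (at y) u"
  have "(?\<phi> has_real_derivative (?Du (x + t *\<^sub>R v + s *\<^sub>R u) - ?Du (x + s *\<^sub>R u))) (at s)"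
    if "0 \<le> s" "s \<le> t" for s
  proof -
    have "x + t *\<^sub>R v + s *\<^sub>R u \<in> ball x \<delta>" "x + s *\<^sub>R u \<in> ball x \<delta>"
      using in_ball[of s t] in_ball[of s 0] that t by (simp_all add: add_ac)
    then show ?thesis
      by (intro DERIV_diff has_real_derivative_line[OF f[unfolded frechet_derivative_works]])
  qed
  from MVT2[of 0 t ?\<phi>, OF \<open>t > 0\<close> this] obtain \<xi> where \<xi>: "0 < \<xi>" "\<xi> < t"
    "?\<phi> t - ?\<phi> 0 = t * (?Du (x + t *\<^sub>R v + \<xi> *\<^sub>R u) - ?Du (x + \<xi> *\<^sub>R u))"
    by auto
  let ?\<psi> = "\<lambda>s. ?Du (x + \<xi> *\<^sub>R u + s *\<^sub>R v)"
  have "(?\<psi> has_real_derivative (frechet_derivative ?Du (at (x + \<xi> *\<^sub>R u + s *\<^sub>R v)) v)) (at s)"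
    if "0 \<le> s" "s \<le> t" for s
    by (rule has_real_derivative_line)
       (use fu[OF in_ball[of \<xi> s]] \<xi> that in \<open>simp add: frechet_derivative_works\<close>)
  from MVT2[of 0 t ?\<psi>, OF \<open>t > 0\<close> this] obtain \<eta> where \<eta>: "0 < \<eta>" "\<eta> < t"
    "?\<psi> t - ?\<psi> 0 = t * frechet_derivative ?Du (at (x + \<xi> *\<^sub>R u + \<eta> *\<^sub>R v)) v"
    by auto
  have "f (x + t *\<^sub>R u + t *\<^sub>R v) - f (x + t *\<^sub>R u) - f (x + t *\<^sub>R v) + f x = ?\<phi> t - ?\<phi> 0"
    by (simp add: add_ac)
  also have "\<dots> = t * (?\<psi> t - ?\<psi> 0)" using \<xi>(3) by (simp add: add_ac)
  also have "\<dots> = t * t * frechet_derivative ?Du (at (x + \<xi> *\<^sub>R u + \<eta> *\<^sub>R v)) v"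
    unfolding \<eta>(3) by simp
  finally show ?thesis using in_ball[of \<xi> \<eta>] \<xi> \<eta> by (meson less_imp_le)
qed

text \<open>The same second difference is evaluated in both orders, so the two mixed derivatives
  agree at two points close to \<open>x\<close>; continuity brings both points to \<open>x\<close>.
  Real values are required by the mean value theorem.\<close>

lemma frechet_derivative_commute_real:
  fixes f :: "'a::real_normed_vector \<Rightarrow> real"
  assumes "open S" "x \<in> S" "smooth_on S f"
  shows "frechet_derivative (\<lambda>y. frechet_derivative f (at y) u) (at x) v =
    frechet_derivative (\<lambda>y. frechet_derivative f (at y) v) (at x) u"
proof -
  define D2 where "D2 u v y = frechet_derivative (\<lambda>y. frechet_derivative f (at y) u) (at y) v" for u v y
  have cont: "isCont (D2 u v) x" for u v
    using smooth_on_imp_continuous_on[OF smooth_on_frechet_derivative[OF smooth_on_frechet_derivative[OF assms(3)]]]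
      assms(1,2) unfolding D2_def by (metis (no_types, lifting) continuous_on_eq_continuous_at)
  have "\<bar>D2 u v x - D2 v u x\<bar> < \<epsilon>" if "\<epsilon> > 0" for \<epsilon>
  proof -
    have "eventually (\<lambda>y. y \<in> S \<and> dist (D2 u v y) (D2 u v x) < \<epsilon>/2 \<and> dist (D2 v u y) (D2 v u x) < \<epsilon>/2)
        (nhds x)"
      using that assms cont[of u v] cont[of v u] unfolding isCont_def tendsto_at_iff_tendsto_nhds
      by (intro eventually_conj eventually_nhds_in_open tendstoD) auto
    then obtain \<delta> where "\<delta> > 0" and \<delta>: "\<And>y. dist y x < \<delta> \<Longrightarrow>
        y \<in> S \<and> dist (D2 u v y) (D2 u v x) < \<epsilon>/2 \<and> dist (D2 v u y) (D2 v u x) < \<epsilon>/2"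
      unfolding eventually_nhds_metric by blast
    \<comment> \<open>The summand 1 avoids a division by zero when \<open>u\<close> and
      \<open>v\<close> both vanish; the factor 2 leaves room for a strict inequality.\<close>
    define t where "t = \<delta> / (2 * (norm u + norm v + 1))"
    have pos: "norm u + norm v + 1 > 0" by (simp add: add_nonneg_pos)
    have "t > 0" using \<open>\<delta> > 0\<close> pos by (simp add: t_def)
    have "t * (norm u + norm v) < t * (2 * (norm u + norm v + 1))"
      using \<open>t > 0\<close> pos by (intro mult_strict_left_mono) auto
    also have "\<dots> = \<delta>" using pos unfolding t_def by (simp add: field_simps)
    finally have t: "t * (norm u + norm v) < \<delta>" "t * (norm v + norm u) < \<delta>" by (simp_all add: add.commute)
    have diff: "f differentiable (at y)" "(\<lambda>y. frechet_derivative f (at y) w) differentiable (at y)"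
      if "y \<in> ball x \<delta>" for y w
    proof -
      have "y \<in> S" using \<delta>[of y] that by (simp add: dist_commute)
      then show "f differentiable (at y)" "(\<lambda>y. frechet_derivative f (at y) w) differentiable (at y)"
        using smooth_on_has_derivative[OF assms(3)]
          smooth_on_has_derivative[OF smooth_on_frechet_derivative[OF assms(3)]] differentiableI by blast+
    qed
    obtain y z where y: "y \<in> ball x \<delta>" "f (x + t *\<^sub>R u + t *\<^sub>R v) - f (x + t *\<^sub>R u) - f (x + t *\<^sub>R v) + f x =
        t * t * D2 u v y" and z: "z \<in> ball x \<delta>"
        "f (x + t *\<^sub>R v + t *\<^sub>R u) - f (x + t *\<^sub>R v) - f (x + t *\<^sub>R u) + f x = t * t * D2 v u z"
      using second_difference_mean_value[OF diff \<open>t > 0\<close> t(1)]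
        second_difference_mean_value[OF diff \<open>t > 0\<close> t(2)] unfolding D2_def by metis
    have "t * t * D2 u v y = t * t * D2 v u z" using y(2) z(2) by (simp add: algebra_simps)
    then have "D2 u v y = D2 v u z" using \<open>t > 0\<close> by simp
    moreover have "dist (D2 u v y) (D2 u v x) < \<epsilon>/2" "dist (D2 v u z) (D2 v u x) < \<epsilon>/2"
      using \<delta>[of y] \<delta>[of z] y(1) z(1) by (simp_all add: dist_commute)
    ultimately have "dist (D2 u v x) (D2 v u x) < \<epsilon>"
      using \<open>D2 u v y = D2 v u z\<close> by (metis dist_triangle_half_r)
    then show ?thesis by (simp add: dist_real_def)
  qed
  \<comment> \<open>If the two values differed, taking their distance as \<epsilon> would make it
    smaller than itself.\<close>
  from this[of "\<bar>D2 u v x - D2 v u x\<bar>"] show ?thesis unfolding D2_def by fastforce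
qed

subsection \<open>Partial derivatives\<close>

lemma partial_cong:
  "open S \<Longrightarrow> x \<in> S \<Longrightarrow> (\<And>y. y \<in> S \<Longrightarrow> f y = g y) \<Longrightarrow>
    f differentiable (at x) \<Longrightarrow> partial i f x = partial i g x"
  unfolding partial_def by (subst frechet_derivative_transform_within_open) auto

lemma smooth_on_differentiable: "smooth_on S f \<Longrightarrow> x \<in> S \<Longrightarrow> f differentiable (at x)"
  using smooth_on_has_derivative differentiableI by blast

lemma smooth_on_partial: "smooth_on S f \<Longrightarrow> smooth_on S (partial i f)"
  unfolding partial_def by (rule smooth_on_frechet_derivative)

lemma partial_eqI: "(f has_derivative f') (at x) \<Longrightarrow> partial i f x = f' (axis i 1)"
  unfolding partial_def by (metis frechet_derivative_at)

lemma partial_const: "partial i (\<lambda>x. c) x = 0"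
  by (simp add: partial_def)

lemma partial_add:
  assumes "smooth_on S f" "smooth_on S g" "x \<in> S"
  shows "partial i (\<lambda>x. f x + g x) x = partial i f x + partial i g x"
  by (subst partial_eqI[OF has_derivative_add[OF assms(1,2)[THEN smooth_on_has_derivative, OF assms(3)]]])
     (simp add: partial_def)

lemma partial_mult:
  assumes "smooth_on S f" "smooth_on S g" "x \<in> S"
  shows "partial i (\<lambda>x. f x * g x) x = f x * partial i g x + partial i f x * g x"
  by (subst partial_eqI[OF has_derivative_mult[OF assms(1,2)[THEN smooth_on_has_derivative, OF assms(3)]]])
     (simp add: partial_def)

lemma partial_cmult:
  assumes "smooth_on S f" "x \<in> S"
  shows "partial i (\<lambda>x. a * f x) x = a * partial i f x"
  using partial_mult[OF smooth_on_const assms, of i a] by (simp add: partial_const)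

lemma partial_compose:
  fixes G :: "real ^ 'd \<Rightarrow> real ^ 'd"
  assumes "(k has_derivative k') (at (G x))" "(G has_derivative G') (at x)"
  shows "partial i (\<lambda>x. k (G x)) x =
    (\<Sum>j\<in>UNIV. of_real (G' (axis i 1) $ j) * partial j k (G x))"
proof -
  have "partial i (\<lambda>x. k (G x)) x = k' (G' (axis i 1))"
    by (rule partial_eqI[OF has_derivative_compose[OF assms(2,1)]])
  also have "\<dots> = k' (\<Sum>j\<in>UNIV. (G' (axis i 1) $ j) *\<^sub>R axis j 1)"
    by (simp add: basis_expansion scalar_mult_eq_scaleR[symmetric])
  also have "\<dots> = (\<Sum>j\<in>UNIV. (G' (axis i 1) $ j) *\<^sub>R k' (axis j 1))"
    using has_derivative_linear[OF assms(1)] by (simp add: linear_sum linear_cmul)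
  finally show ?thesis
    using partial_eqI[OF assms(1)] by (simp add: scaleR_conv_of_real)
qed

lemma frechet_derivative_bounded_linear_compose:
  assumes "bounded_linear L" "f differentiable (at x)"
  shows "frechet_derivative (\<lambda>x. L (f x)) (at x) v = L (frechet_derivative f (at x) v)"
  using bounded_linear.has_derivative[OF assms(1)] assms(2) frechet_derivative_at
  unfolding frechet_derivative_works by metis

text \<open>Real and imaginary parts are bounded linear and commute with differentiation, which
  reduces the complex case to the real one.\<close>

lemma partial_commute:
  fixes f :: "real ^ 'd \<Rightarrow> complex"
  assumes "open S" "x \<in> S" "smooth_on S f"
  shows "partial i (partial j f) x = partial j (partial i f) x"
proof -
  have *: "L (partial i (partial j f) x) =
      frechet_derivative (\<lambda>y. frechet_derivative (\<lambda>y. L (f y)) (at y) (axis j 1)) (at x) (axis i 1)"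
    if L: "bounded_linear (L :: complex \<Rightarrow> real)" for L i j
  proof -
    have "L (partial i (partial j f) x) = frechet_derivative (\<lambda>y. L (partial j f y)) (at x) (axis i 1)"
      using frechet_derivative_bounded_linear_compose[OF L
          smooth_on_differentiable[OF smooth_on_partial[OF assms(3)] assms(2)]]
      by (simp add: partial_def[of i])
    also have "frechet_derivative (\<lambda>y. L (partial j f y)) (at x) =
        frechet_derivative (\<lambda>y. frechet_derivative (\<lambda>y. L (f y)) (at y) (axis j 1)) (at x)"
    proof (rule frechet_derivative_transform_within_open[OF _ \<open>open S\<close> \<open>x \<in> S\<close>])
      show "(\<lambda>y. L (partial j f y)) differentiable at x"
        by (rule smooth_on_differentiable[OF smooth_on_bounded_linear_compose[OF assms(1) L
                smooth_on_partial[OF assms(3)]] assms(2)])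
      show "L (partial j f y) = frechet_derivative (\<lambda>y. L (f y)) (at y) (axis j 1)" if "y \<in> S" for y
        using frechet_derivative_bounded_linear_compose[OF L smooth_on_differentiable[OF assms(3) that]]
        by (simp add: partial_def)
    qed
    finally show ?thesis .
  qed
  have "L (partial i (partial j f) x) = L (partial j (partial i f) x)"
    if L: "bounded_linear (L :: complex \<Rightarrow> real)" for L
    unfolding *[OF L]
    by (rule frechet_derivative_commute_real[OF assms(1,2)
          smooth_on_bounded_linear_compose[OF assms(1) L assms(3)]])
  from this[OF bounded_linear_Re] this[OF bounded_linear_Im] show ?thesis
    by (simp add: complex_eq_iff)
qed

lemma smooth_on_funpow_partial: "smooth_on S f \<Longrightarrow> smooth_on S ((partial i ^^ n) f)"
  by (induction n) (auto intro: smooth_on_partial)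

lemma funpow_partial_cong:
  assumes "open S" "smooth_on S f" "\<And>x. x \<in> S \<Longrightarrow> f x = g x" "x \<in> S"
  shows "(partial i ^^ n) f x = (partial i ^^ n) g x"
  using assms(4)
proof (induction n arbitrary: x)
  case (Suc n)
  show ?case
    using partial_cong[OF assms(1) Suc.prems Suc.IH
        smooth_on_differentiable[OF smooth_on_funpow_partial[OF assms(2)] Suc.prems]] by simp
qed (simp add: assms)

lemma funpow_partial_commute:
  fixes f :: "real ^ 'd \<Rightarrow> complex"
  assumes "open S" "smooth_on S f" "x \<in> S"
  shows "(partial i ^^ n) (partial j f) x = partial j ((partial i ^^ n) f) x"
  using assms(3)
proof (induction n arbitrary: x)
  case (Suc n)
  have "(partial i ^^ Suc n) (partial j f) x = partial i (partial j ((partial i ^^ n) f)) x"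
    using partial_cong[OF assms(1) Suc.prems Suc.IH
        smooth_on_differentiable[OF smooth_on_funpow_partial[OF smooth_on_partial[OF assms(2)]] Suc.prems]]
    by simp
  also have "\<dots> = partial j ((partial i ^^ Suc n) f) x"
    using partial_commute[OF assms(1) Suc.prems smooth_on_funpow_partial[OF assms(2)]] by simp
  finally show ?case .
qed simp

text \<open>The enumeration hidden in \<open>multi_partial\<close> is an unspecified choice; an
  arbitrary list in its place makes induction over the coordinates possible.\<close>

definition list_partial :: "'d::finite list \<Rightarrow> ('d \<Rightarrow> nat) \<Rightarrow> (real ^ 'd \<Rightarrow> complex) \<Rightarrow> real ^ 'd \<Rightarrow> complex" where
  "list_partial is m = foldr (\<lambda>i. partial i ^^ m i) is"

lemma list_partial_simps [simp]:
  "list_partial [] m g = g"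
  "list_partial (i # is) m g = (partial i ^^ m i) (list_partial is m g)"
  by (simp_all add: list_partial_def)

lemma smooth_on_list_partial: "smooth_on S f \<Longrightarrow> smooth_on S (list_partial is m f)"
  by (induction "is") (auto intro: smooth_on_funpow_partial)

lemma list_partial_commute:
  assumes "open S" "smooth_on S f" "x \<in> S"
  shows "list_partial is m (partial j f) x = partial j (list_partial is m f) x"
  using assms(3)
proof (induction "is" arbitrary: x)
  case (Cons i "is")
  have "list_partial (i # is) m (partial j f) x = (partial i ^^ m i) (partial j (list_partial is m f)) x"
    using funpow_partial_cong[OF assms(1) smooth_on_list_partial[OF smooth_on_partial[OF assms(2)]]
        Cons.IH Cons.prems] by simp
  also have "\<dots> = partial j (list_partial (i # is) m f) x"
    using funpow_partial_commute[OF assms(1) smooth_on_list_partial[OF assms(2)] Cons.prems] by simp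
  finally show ?case .
qed simp

text \<open>As the list is distinct, the additional derivative appears at a single position, and
  from there it is commuted through the remaining ones down to \<open>f\<close>.\<close>

lemma list_partial_Suc:
  assumes "open S" "smooth_on S f" "x \<in> S" "distinct is" "i \<in> set is"
  shows "list_partial is (m(i := Suc (m i))) f x = list_partial is m (partial i f) x"
  using assms(3-)
proof (induction "is" arbitrary: x)
  case (Cons j "is")
  note sm = smooth_on_list_partial[OF assms(2)] and
    sm' = smooth_on_list_partial[OF smooth_on_partial[OF assms(2)]]
  show ?case
  proof (cases "i = j")
    case True
    have "foldr (\<lambda>k. partial k ^^ (m(i := Suc (m i))) k) is = foldr (\<lambda>k. partial k ^^ m k) is"
      using Cons.prems True by (intro ext foldr_cong) auto
    then have "list_partial is (m(i := Suc (m i))) f = list_partial is m f"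
      by (simp add: list_partial_def)
    then have "list_partial (j # is) (m(i := Suc (m i))) f x =
        (partial i ^^ m i) (partial i (list_partial is m f)) x"
      using True by (simp add: funpow_swap1)
    also have "\<dots> = (partial i ^^ m i) (list_partial is m (partial i f)) x"
      by (rule funpow_partial_cong[OF assms(1) smooth_on_partial[OF sm] _ Cons.prems(1)])
         (simp add: list_partial_commute[OF assms(1,2)])
    finally show ?thesis by (metis True list_partial_simps(2))
  next
    case False
    then show ?thesis
      using Cons.prems funpow_partial_cong[OF assms(1) sm Cons.IH Cons.prems(1)]
      by simp
  qed
qed simp

lemma multi_partial_zero [simp]: "multi_partial (\<lambda>_. 0) f = f"
proof -
  have "foldr (\<lambda>i. partial i ^^ 0) is f = f" for "is" :: "'a list"
    by (induction "is") auto
  then show ?thesis by (simp add: multi_partial_def)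
qed

lemma multi_partial_eq_list_partial:
  obtains "is" where "distinct is" "set is = (UNIV :: 'd::finite set)"
    "\<And>m f. multi_partial m f = list_partial (is :: 'd list) m f"
proof -
  have "\<exists>is. distinct is \<and> set is = (UNIV :: 'd set)"
    using finite_distinct_list[OF finite, of "UNIV :: 'd set"] by blast
  from someI_ex[OF this] show thesis
    by (intro that) (auto simp: multi_partial_def list_partial_def)
qed

lemma multi_partial_Suc:
  assumes "open S" "smooth_on S f" "x \<in> S"
  shows "multi_partial (m(i := Suc (m i))) f x = multi_partial m (partial i f) x"
proof -
  obtain "is" where "distinct is" "set is = (UNIV :: 'a set)"
    "\<And>m f. multi_partial m f = list_partial (is :: 'a list) m f"
    using multi_partial_eq_list_partial by blast
  then show ?thesis by (simp add: list_partial_Suc[OF assms])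
qed

subsection \<open>Order of vanishing\<close>

text \<open>Order n means that all derivatives of order less than n are zero at \<open>x\<close>.
  Recursion over first partial derivatives makes the product and chain rules plain inductions,
  without multi-index combinatorics.\<close>

primrec vanishes_to_order :: "nat \<Rightarrow> (real ^ 'd::finite \<Rightarrow> complex) \<Rightarrow> real ^ 'd \<Rightarrow> bool" where
  "vanishes_to_order 0 f x \<longleftrightarrow> True"
| "vanishes_to_order (Suc n) f x \<longleftrightarrow> f x = 0 \<and> (\<forall>i. vanishes_to_order n (partial i f) x)"

text \<open>A nonzero multi-index has a positive entry, and lowering that entry splits off an
  innermost partial derivative. The recursion always differentiates innermost first, so this is
  where the order of differentiation must be immaterial.\<close>

lemma vanishes_to_order_iff_multi_partial:
  assumes "open S" "x \<in> S" "smooth_on S f"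
  shows "vanishes_to_order n f x \<longleftrightarrow>
    (\<forall>m. (\<Sum>i\<in>UNIV. m i) < n \<longrightarrow> multi_partial m f x = 0)"
  using assms(3)
proof (induction n arbitrary: f)
  case (Suc n)
  note Suc_eq = multi_partial_Suc[OF assms(1) Suc.prems assms(2)]
  have sum_Suc: "(\<Sum>k\<in>UNIV. (m(i := Suc (m i))) k) = Suc (\<Sum>k\<in>UNIV. m k)" for m :: "'a \<Rightarrow> nat" and i
    by (simp add: sum.remove[of UNIV i])
  note IH = Suc.IH[OF smooth_on_partial[OF Suc.prems]]
  show ?case
  proof
    assume v: "vanishes_to_order (Suc n) f x"
    show "\<forall>m. (\<Sum>i\<in>UNIV. m i) < Suc n \<longrightarrow> multi_partial m f x = 0"
    proof (intro allI impI)
      fix m :: "'a \<Rightarrow> nat" assume m: "(\<Sum>i\<in>UNIV. m i) < Suc n"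
      show "multi_partial m f x = 0"
      proof (cases "\<exists>i. m i > 0")
        case True
        then obtain i where i: "m i > 0" by blast
        define m' where "m' = m(i := m i - 1)"
        have m_eq: "m = m'(i := Suc (m' i))" using i by (auto simp: m'_def)
        have "(\<Sum>k\<in>UNIV. m' k) < n" using m sum_Suc[of m' i] unfolding m_eq[symmetric] by simp
        then have "multi_partial m' (partial i f) x = 0" using v IH by auto
        then show ?thesis using Suc_eq[of m' i] unfolding m_eq[symmetric] by simp
      next
        case False
        then have "m = (\<lambda>_. 0)" by auto
        then show ?thesis using v by simp
      qed
    qed
  next
    assume all: "\<forall>m. (\<Sum>i\<in>UNIV. m i) < Suc n \<longrightarrow> multi_partial m f x = 0"
    have "vanishes_to_order n (partial i f) x" for i
      unfolding IH using all sum_Suc Suc_eq by (metis Suc_less_eq)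
    moreover have "f x = 0"
      using all[rule_format, of "\<lambda>_. 0"] by simp
    ultimately show "vanishes_to_order (Suc n) f x" by simp
  qed
qed simp

lemma vanishes_to_order_SucD: "vanishes_to_order (Suc n) f x \<Longrightarrow> vanishes_to_order n f x"
  by (induction n arbitrary: f) auto

lemma vanishes_to_order_cong:
  assumes "open S" "x \<in> S" "smooth_on S f" "\<And>y. y \<in> S \<Longrightarrow> f y = g y" "vanishes_to_order n f x"
  shows "vanishes_to_order n g x"
  using assms(3-)
proof (induction n arbitrary: f g)
  case (Suc n)
  have "partial i f y = partial i g y" if "y \<in> S" for y i
    using partial_cong[OF assms(1) that Suc.prems(2)] smooth_on_differentiable[OF Suc.prems(1) that] by auto
  then have "vanishes_to_order n (partial i g) x" for i
    by (rule Suc.IH[OF smooth_on_partial[OF Suc.prems(1), where i = i]])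
       (use Suc.prems(3) in auto)
  then show ?case using Suc.prems assms(2) by simp
qed simp

lemma vanishes_to_order_zero: "vanishes_to_order n (\<lambda>x. 0) x"
proof (induction n)
  case (Suc n)
  have "partial i (\<lambda>x. 0) = (\<lambda>x :: real ^ 'a. 0)" for i by (simp add: fun_eq_iff partial_const)
  then show ?case using Suc by simp
qed simp

lemma vanishes_to_order_add:
  assumes "open S" "x \<in> S" "smooth_on S f" "smooth_on S g"
    "vanishes_to_order n f x" "vanishes_to_order n g x"
  shows "vanishes_to_order n (\<lambda>x. f x + g x) x"
  using assms(3-)
proof (induction n arbitrary: f g)
  case (Suc n)
  have "vanishes_to_order n (partial i (\<lambda>x. f x + g x)) x" for i
    by (rule vanishes_to_order_cong[OF assms(1,2) _ _
          Suc.IH[of "partial i f" "partial i g"]])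
       (use Suc.prems in \<open>auto intro: smooth_on_partial smooth_on_add assms(1)
          simp: partial_add[OF Suc.prems(1,2)]\<close>)
  then show ?case using Suc.prems by simp
qed simp

lemma vanishes_to_order_sum:
  assumes "open S" "x \<in> S" "\<And>i. i \<in> I \<Longrightarrow> smooth_on S (f i)"
    "\<And>i. i \<in> I \<Longrightarrow> vanishes_to_order n (f i) x"
  shows "vanishes_to_order n (\<lambda>x. \<Sum>i\<in>I. f i x) x"
  using assms(3-)
  by (induction I rule: infinite_finite_induct)
     (auto intro!: vanishes_to_order_zero vanishes_to_order_add[OF assms(1,2)] smooth_on_sum assms(1))

lemma vanishes_to_order_mult:
  assumes "open S" "x \<in> S" "smooth_on S f" "smooth_on S g" "vanishes_to_order n f x"
  shows "vanishes_to_order n (\<lambda>x. f x * g x) x"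
  using assms(3-)
proof (induction n arbitrary: f g)
  case (Suc n)
  have "vanishes_to_order n (partial i (\<lambda>x. f x * g x)) x" for i
  proof (rule vanishes_to_order_cong[OF assms(1,2)])
    show "vanishes_to_order n (\<lambda>x. f x * partial i g x + partial i f x * g x) x"
      using Suc.prems vanishes_to_order_SucD[OF Suc.prems(3)]
      by (intro vanishes_to_order_add[OF assms(1,2)] Suc.IH smooth_on_mult smooth_on_partial assms(1))
         auto
    show "smooth_on S (\<lambda>x. f x * partial i g x + partial i f x * g x)"
      using Suc.prems by (intro smooth_on_add smooth_on_mult smooth_on_partial assms(1)) auto
  qed (simp add: partial_mult[OF Suc.prems(1,2)])
  then show ?case using Suc.prems by simp
qed simp

text \<open>In the product rule the term with the undifferentiated \<open>f\<close> already has the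
  required order; only the term with \<open>g\<close> undifferentiated uses the induction
  hypothesis. Needed for powers of a coordinate.\<close>

lemma vanishes_to_order_mult_Suc:
  assumes "open S" "x \<in> S" "smooth_on S f" "smooth_on S g" "vanishes_to_order n f x" "g x = 0"
  shows "vanishes_to_order (Suc n) (\<lambda>x. f x * g x) x"
  using assms(3-)
proof (induction n arbitrary: f g)
  case 0
  then show ?case by simp
next
  case (Suc n)
  have "vanishes_to_order (Suc n) (partial i (\<lambda>x. f x * g x)) x" for i
  proof (rule vanishes_to_order_cong[OF assms(1,2)])
    show "vanishes_to_order (Suc n) (\<lambda>x. f x * partial i g x + partial i f x * g x) x"
    proof (rule vanishes_to_order_add[OF assms(1,2)])
      show "vanishes_to_order (Suc n) (\<lambda>x. partial i f x * g x) x"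
        using Suc.prems by (intro Suc.IH smooth_on_partial) auto
      show "vanishes_to_order (Suc n) (\<lambda>x. f x * partial i g x) x"
        using Suc.prems by (intro vanishes_to_order_mult[OF assms(1,2)] smooth_on_partial)
    qed (use Suc.prems in \<open>auto intro!: smooth_on_mult smooth_on_partial assms(1)\<close>)
    show "smooth_on S (\<lambda>x. f x * partial i g x + partial i f x * g x)"
      using Suc.prems by (intro smooth_on_add smooth_on_mult smooth_on_partial assms(1)) auto
  qed (simp add: partial_mult[OF Suc.prems(1,2)])
  then show ?case using Suc.prems by simp
qed

lemma smooth_on_jacobian:
  "open S \<Longrightarrow> smooth_on S G \<Longrightarrow>
    smooth_on S (\<lambda>y. complex_of_real (frechet_derivative G (at y) v $ j))"
  by (rule smooth_on_bounded_linear_compose[OF _ _ smooth_on_frechet_derivative,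
        of _ "\<lambda>x. complex_of_real (x $ j)"])
     (auto intro: bounded_linear_compose[OF bounded_linear_of_real bounded_linear_vec_nth])

lemma partial_compose_smooth:
  fixes G :: "real ^ 'd \<Rightarrow> real ^ 'd"
  assumes "smooth_on S k" "smooth_on T G" "G ` T \<subseteq> S" "x \<in> T"
  shows "partial i (\<lambda>x. k (G x)) x =
    (\<Sum>j\<in>UNIV. of_real (frechet_derivative G (at x) (axis i 1) $ j) * partial j k (G x))"
  by (rule partial_compose) (use assms in \<open>auto intro: smooth_on_has_derivative\<close>)

text \<open>By the first-order chain rule each partial derivative of the composite is a sum of
  \<open>partial j k\<close> composed with \<open>G\<close>, times smooth Jacobian entries. The
  induction runs over all \<open>k\<close>, so these composites are covered, and a smooth factor
  does not lower the order.\<close>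

lemma vanishes_to_order_compose:
  fixes G :: "real ^ 'd \<Rightarrow> real ^ 'd"
  assumes "open S" "open T" "smooth_on S k" "smooth_on T G" "G ` T \<subseteq> S" "x \<in> T"
    "vanishes_to_order n k (G x)"
  shows "vanishes_to_order n (\<lambda>x. k (G x)) x"
  using assms(3,7)
proof (induction n arbitrary: k)
  case (Suc n)
  let ?J = "\<lambda>i j y. complex_of_real (frechet_derivative G (at y) (axis i 1) $ j)"
  have sm: "smooth_on T (\<lambda>y. partial j k (G y))" "smooth_on T (?J i j)" for i j
    by (auto intro: smooth_on_compose[OF assms(2,1,5,4) smooth_on_partial[OF Suc.prems(1)]]
        smooth_on_jacobian assms)
  have "vanishes_to_order n (partial i (\<lambda>x. k (G x))) x" for i
  proof (rule vanishes_to_order_cong[OF assms(2,6)])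
    show "vanishes_to_order n (\<lambda>y. \<Sum>j\<in>UNIV. partial j k (G y) * ?J i j y) x"
      by (intro vanishes_to_order_sum[OF assms(2,6)] vanishes_to_order_mult[OF assms(2,6)]
          smooth_on_mult sm assms(2) Suc.IH smooth_on_partial) (use Suc.prems in auto)
    show "smooth_on T (\<lambda>y. \<Sum>j\<in>UNIV. partial j k (G y) * ?J i j y)"
      by (intro smooth_on_sum smooth_on_mult sm assms(2))
  qed (simp add: partial_compose_smooth[OF Suc.prems(1) assms(4,5)] mult.commute)
  then show ?case using Suc.prems by simp
qed simp

subsection \<open>Complex directional derivatives\<close>

text \<open>The eigenvector may be non-real, so the direction \<open>z\<close> is complex; its
  coefficients are constant in the chart.\<close>

definition complex_derivative ::
    "('d::finite \<Rightarrow> complex) \<Rightarrow> (real ^ 'd \<Rightarrow> complex) \<Rightarrow> real ^ 'd \<Rightarrow> complex" where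
  "complex_derivative z f = (\<lambda>x. \<Sum>i\<in>UNIV. z i * partial i f x)"

lemma smooth_on_complex_derivative:
  "open S \<Longrightarrow> smooth_on S f \<Longrightarrow> smooth_on S (complex_derivative z f)"
  unfolding complex_derivative_def by (intro smooth_on_sum smooth_on_cmult smooth_on_partial)

lemma vanishes_to_order_complex_derivative:
  assumes "open S" "x \<in> S" "smooth_on S f" "vanishes_to_order (Suc n) f x"
  shows "vanishes_to_order n (complex_derivative z f) x"
proof -
  have "vanishes_to_order n (\<lambda>x. \<Sum>i\<in>UNIV. partial i f x * z i) x"
    using assms
    by (intro vanishes_to_order_sum[OF assms(1,2)] vanishes_to_order_mult[OF assms(1,2)]
        smooth_on_mult smooth_on_const smooth_on_partial) auto
  then show ?thesis by (simp add: complex_derivative_def mult.commute)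
qed

lemma complex_derivative_cong:
  assumes "open S" "x \<in> S" "smooth_on S f" "\<And>y. y \<in> S \<Longrightarrow> f y = g y"
  shows "complex_derivative z f x = complex_derivative z g x"
  unfolding complex_derivative_def
  using partial_cong[OF assms(1,2,4)] smooth_on_differentiable[OF assms(3,2)] by simp

lemma complex_derivative_mult:
  assumes "smooth_on S f" "smooth_on S g" "x \<in> S"
  shows "complex_derivative z (\<lambda>x. f x * g x) x =
    f x * complex_derivative z g x + complex_derivative z f x * g x"
  unfolding complex_derivative_def
  by (simp add: partial_mult[OF assms] sum_distrib_left sum_distrib_right sum.distrib
      distrib_left mult_ac)

lemma complex_derivative_add:
  assumes "smooth_on S f" "smooth_on S g" "x \<in> S"
  shows "complex_derivative z (\<lambda>x. f x + g x) x = complex_derivative z f x + complex_derivative z g x"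
  unfolding complex_derivative_def
  by (simp add: partial_add[OF assms] sum.distrib distrib_left)

lemma smooth_on_funpow_complex_derivative:
  "open S \<Longrightarrow> smooth_on S f \<Longrightarrow> smooth_on S ((complex_derivative z ^^ n) f)"
  by (induction n) (auto intro: smooth_on_complex_derivative)

lemma funpow_complex_derivative_cong:
  assumes "open S" "x \<in> S" "smooth_on S f" "\<And>y. y \<in> S \<Longrightarrow> f y = g y"
  shows "(complex_derivative z ^^ n) f x = (complex_derivative z ^^ n) g x"
  using assms(2)
proof (induction n arbitrary: x)
  case (Suc n)
  then show ?case
    using complex_derivative_cong[OF assms(1) _ smooth_on_funpow_complex_derivative[OF assms(1,3)]]
    by simp
qed (simp add: assms(4))

lemma funpow_complex_derivative_add:
  assumes "open S" "x \<in> S" "smooth_on S f" "smooth_on S g"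
  shows "(complex_derivative z ^^ n) (\<lambda>x. f x + g x) x =
    (complex_derivative z ^^ n) f x + (complex_derivative z ^^ n) g x"
  using assms(2)
proof (induction n arbitrary: x)
  case (Suc n)
  note sm = assms(3,4)[THEN smooth_on_funpow_complex_derivative[OF assms(1)], of n z]
  have "(complex_derivative z ^^ Suc n) (\<lambda>x. f x + g x) x =
    complex_derivative z (\<lambda>x. (complex_derivative z ^^ n) f x + (complex_derivative z ^^ n) g x) x"
    using complex_derivative_cong[OF assms(1) Suc.prems
        smooth_on_funpow_complex_derivative[OF assms(1) smooth_on_add[OF assms(1,3,4)]] Suc.IH]
    by simp
  then show ?case using complex_derivative_add[OF sm Suc.prems] by simp
qed simp

lemma complex_derivative_cmult:
  assumes "smooth_on S f" "x \<in> S"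
  shows "complex_derivative z (\<lambda>x. a * f x) x = a * complex_derivative z f x"
  unfolding complex_derivative_def by (simp add: partial_cmult[OF assms] sum_distrib_left mult_ac)

lemma funpow_complex_derivative_cmult:
  assumes "open S" "x \<in> S" "smooth_on S f"
  shows "(complex_derivative z ^^ n) (\<lambda>x. a * f x) x = a * (complex_derivative z ^^ n) f x"
  using assms(2)
proof (induction n arbitrary: x)
  case (Suc n)
  have "(complex_derivative z ^^ Suc n) (\<lambda>x. a * f x) x =
      complex_derivative z (\<lambda>x. a * (complex_derivative z ^^ n) f x) x"
    using complex_derivative_cong[OF assms(1) Suc.prems
        smooth_on_funpow_complex_derivative[OF assms(1) smooth_on_cmult[OF assms(1,3)]] Suc.IH]
    by simp
  then show ?case
    using complex_derivative_cmult[OF smooth_on_funpow_complex_derivative[OF assms(1,3)] Suc.prems]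
    by simp
qed simp

lemma funpow_complex_derivative_zero: "(complex_derivative z ^^ n) (\<lambda>x. 0) = (\<lambda>x. 0)"
  by (induction n) (auto simp: complex_derivative_def partial_const)

lemma funpow_complex_derivative_sum:
  assumes "open S" "x \<in> S" "\<And>i. i \<in> I \<Longrightarrow> smooth_on S (f i)"
  shows "(complex_derivative z ^^ n) (\<lambda>x. \<Sum>i\<in>I. f i x) x =
    (\<Sum>i\<in>I. (complex_derivative z ^^ n) (f i) x)"
  using assms(3)
proof (induction I rule: infinite_finite_induct)
  case (insert i I)
  then have "(complex_derivative z ^^ n) (\<lambda>x. f i x + (\<Sum>i\<in>I. f i x)) x =
      (complex_derivative z ^^ n) (f i) x + (complex_derivative z ^^ n) (\<lambda>x. \<Sum>i\<in>I. f i x) x"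
    by (intro funpow_complex_derivative_add[OF assms(1,2)] smooth_on_sum assms(1)) auto
  then show ?case using insert by simp
qed (simp_all add: funpow_complex_derivative_zero)

text \<open>Each application costs at most one order of vanishing, so order \<open>Suc n\<close>
  survives \<open>n\<close> of them with one to spare.\<close>

lemma funpow_complex_derivative_eq_0:
  assumes "open S" "x \<in> S" "smooth_on S f" "vanishes_to_order (Suc n) f x"
  shows "(complex_derivative z ^^ n) f x = 0"
  using assms(3,4)
proof (induction n arbitrary: f)
  case (Suc n)
  show ?case
    using Suc.IH[OF smooth_on_complex_derivative[OF assms(1) Suc.prems(1)]
        vanishes_to_order_complex_derivative[OF assms(1,2) Suc.prems]]
    by (simp add: funpow_swap1)
qed simp

text \<open>Only the Leibniz term with all \<open>n\<close> derivatives on \<open>f\<close> survives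
  at \<open>x\<close>. Hence a non-constant factor \<open>g\<close> behaves like the constant
  \<open>g x\<close>.\<close>

lemma funpow_complex_derivative_mult:
  assumes "open S" "x \<in> S" "smooth_on S f" "smooth_on S g" "vanishes_to_order n f x"
  shows "(complex_derivative z ^^ n) (\<lambda>x. f x * g x) x = (complex_derivative z ^^ n) f x * g x"
  using assms(3-)
proof (induction n arbitrary: f g)
  case (Suc n)
  let ?Z = "complex_derivative z"
  note sf = smooth_on_complex_derivative[OF assms(1) Suc.prems(1)]
    and sg = smooth_on_complex_derivative[OF assms(1) Suc.prems(2)]
  have "(?Z ^^ Suc n) (\<lambda>x. f x * g x) x = (?Z ^^ n) (?Z (\<lambda>x. f x * g x)) x"
    by (simp add: funpow_swap1)
  also have "\<dots> = (?Z ^^ n) (\<lambda>x. f x * ?Z g x + ?Z f x * g x) x"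
    by (rule funpow_complex_derivative_cong[OF assms(1,2)
          smooth_on_complex_derivative[OF assms(1) smooth_on_mult[OF assms(1) Suc.prems(1,2)]]
          complex_derivative_mult[OF Suc.prems(1,2)]])
  also have "\<dots> = (?Z ^^ n) (\<lambda>x. f x * ?Z g x) x + (?Z ^^ n) (\<lambda>x. ?Z f x * g x) x"
    using Suc.prems sf sg by (intro funpow_complex_derivative_add[OF assms(1,2)] smooth_on_mult assms(1))
  also have "(?Z ^^ n) (\<lambda>x. f x * ?Z g x) x = (?Z ^^ n) f x * ?Z g x"
    by (rule Suc.IH[OF Suc.prems(1) sg vanishes_to_order_SucD[OF Suc.prems(3)]])
  also have "\<dots> = 0"
    using funpow_complex_derivative_eq_0[OF assms(1,2) Suc.prems(1,3)] by simp
  also have "(?Z ^^ n) (\<lambda>x. ?Z f x * g x) x = (?Z ^^ n) (?Z f) x * g x"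
    by (rule Suc.IH[OF sf Suc.prems(2) vanishes_to_order_complex_derivative[OF assms(1,2) Suc.prems(1,3)]])
  finally show ?case by (simp add: funpow_swap1)
qed simp

text \<open>One derivative of the composite has the variable coefficients \<open>J j\<close>,
  whereas \<open>eigen\<close> controls them at \<open>x\<close> only. That is enough: they multiply
  functions vanishing to order \<open>n\<close> at \<open>x\<close>, so the remaining
  \<open>n\<close> derivatives see them only through their values at \<open>x\<close>, which are
  \<alpha> times \<open>z j\<close>.\<close>

lemma funpow_complex_derivative_compose:
  fixes G :: "real ^ 'd \<Rightarrow> real ^ 'd"
  assumes "open S" "open T" "smooth_on S k" "smooth_on T G" "G ` T \<subseteq> S" "x \<in> T"
    "vanishes_to_order n k (G x)"
    and eigen: "\<And>j. (\<Sum>i\<in>UNIV. z i * of_real (frechet_derivative G (at x) (axis i 1) $ j)) = \<alpha> * z j"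
  shows "(complex_derivative z ^^ n) (\<lambda>x. k (G x)) x = \<alpha> ^ n * (complex_derivative z ^^ n) k (G x)"
  using assms(3,7)
proof (induction n arbitrary: k)
  case (Suc n)
  let ?Z = "complex_derivative z"
  define J where "J j y = (\<Sum>i\<in>UNIV. z i * complex_of_real (frechet_derivative G (at y) (axis i 1) $ j))" for j y
  have Gx: "G x \<in> S" using assms by auto
  have smJ: "smooth_on T (J j)" for j
    unfolding J_def by (intro smooth_on_sum smooth_on_cmult smooth_on_jacobian assms)
  note sp = smooth_on_partial[OF Suc.prems(1)]
  have smk: "smooth_on T (\<lambda>y. partial j k (G y))" for j
    by (rule smooth_on_compose[OF assms(2,1,5,4) sp])
  have vp: "vanishes_to_order n (partial j k) (G x)" for j using Suc.prems by simp
  have *: "?Z (\<lambda>x. k (G x)) y = (\<Sum>j\<in>UNIV. partial j k (G y) * J j y)" if "y \<in> T" for y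
    unfolding complex_derivative_def partial_compose_smooth[OF Suc.prems(1) assms(4,5) that] J_def
    by (simp add: sum_distrib_left sum_distrib_right mult_ac) (rule sum.swap)
  have "(?Z ^^ Suc n) (\<lambda>x. k (G x)) x = (?Z ^^ n) (?Z (\<lambda>x. k (G x))) x"
    by (simp add: funpow_swap1)
  also have "\<dots> = (?Z ^^ n) (\<lambda>y. \<Sum>j\<in>UNIV. partial j k (G y) * J j y) x"
    by (rule funpow_complex_derivative_cong[OF assms(2,6)
          smooth_on_complex_derivative[OF assms(2) smooth_on_compose[OF assms(2,1,5,4) Suc.prems(1)]] *])
  also have "\<dots> = (\<Sum>j\<in>UNIV. (?Z ^^ n) (\<lambda>y. partial j k (G y) * J j y) x)"
    by (intro funpow_complex_derivative_sum[OF assms(2,6)] smooth_on_mult assms(2) smk smJ)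
  also have "\<dots> = (\<Sum>j\<in>UNIV. (?Z ^^ n) (\<lambda>y. partial j k (G y)) x * J j x)"
    by (intro sum.cong refl funpow_complex_derivative_mult[OF assms(2,6) smk smJ]
        vanishes_to_order_compose[OF assms(1,2) sp assms(4,5,6) vp])
  also have "\<dots> = (\<Sum>j\<in>UNIV. \<alpha> ^ Suc n * ((?Z ^^ n) (partial j k) (G x) * z j))"
    by (simp add: J_def eigen Suc.IH[OF sp vp] mult_ac)
  \<comment> \<open>The constants \<open>z j\<close> go back inside the derivatives, so that the sum
    becomes one further complex derivative of \<open>k\<close>.\<close>
  also have "\<dots> = \<alpha> ^ Suc n * (\<Sum>j\<in>UNIV. (?Z ^^ n) (\<lambda>y. partial j k y * z j) (G x))"
    by (simp only: sum_distrib_left funpow_complex_derivative_mult[OF assms(1) Gx sp smooth_on_const vp])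
  also have "(\<Sum>j\<in>UNIV. (?Z ^^ n) (\<lambda>y. partial j k y * z j) (G x)) =
      (?Z ^^ n) (\<lambda>y. \<Sum>j\<in>UNIV. partial j k y * z j) (G x)"
    by (intro funpow_complex_derivative_sum[OF assms(1) Gx, symmetric] smooth_on_mult assms(1) sp smooth_on_const)
  also have "(\<lambda>y. \<Sum>j\<in>UNIV. partial j k y * z j) = ?Z k"
    by (simp add: complex_derivative_def mult.commute)
  finally show ?case by (simp add: funpow_swap1)
qed simp

subsection \<open>Bump functions\<close>

text \<open>The classical flat function exp(-1/t) is the case \<open>n = 0\<close>. The powers of
  1/t make the family closed, up to linear combinations, under differentiation, so smoothness is one
  induction over all members.\<close>

definition exp_bump :: "nat \<Rightarrow> real \<Rightarrow> real" where
  "exp_bump n t = (if t > 0 then inverse t ^ n * exp (- inverse t) else 0)"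

lemma exp_bump_tendsto_0: "(exp_bump n \<longlongrightarrow> 0) (at 0)"
proof (rule filterlim_split_at)
  show "(exp_bump n \<longlongrightarrow> 0) (at_left 0)"
    by (rule Lim_transform_eventually[OF tendsto_const])
       (auto simp: exp_bump_def eventually_at_filter)
  show "(exp_bump n \<longlongrightarrow> 0) (at_right 0)"
    unfolding filterlim_at_right_to_top
  proof (rule Lim_transform_eventually[OF tendsto_power_div_exp_0[of n]])
    show "eventually (\<lambda>x. x ^ n / exp x = exp_bump n (inverse x)) at_top"
      using eventually_gt_at_top[of 0]
      by eventually_elim (simp add: exp_bump_def exp_minus field_simps)
  qed
qed

lemma exp_bump_has_derivative:
  "(exp_bump n has_real_derivative exp_bump (n + 2) t - real n * exp_bump (n + 1) t) (at t)"
proof -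
  consider "t < 0" | "t = 0" | "t > 0" by linarith
  then show ?thesis
  proof cases
    case 1
    have "((\<lambda>_. 0) has_real_derivative exp_bump (n + 2) t - real n * exp_bump (n + 1) t) (at t)"
      using 1 by (simp add: exp_bump_def)
    then show ?thesis
      by (rule has_field_derivative_transform_within_open[of _ _ _ "{..<0}"])
         (use 1 in \<open>auto simp: exp_bump_def\<close>)
  next
    case 2
    \<comment> \<open>The difference quotient at 0 is the next member of the family, whose limit is
      known.\<close>
    have "((\<lambda>h. (exp_bump n (0 + h) - exp_bump n 0) / h) \<longlongrightarrow> 0) (at 0)"
      by (rule Lim_transform_eventually[OF exp_bump_tendsto_0[of "n + 1"]])
         (auto simp: exp_bump_def eventually_at_filter field_simps)
    then show ?thesis using 2 by (simp add: DERIV_def exp_bump_def)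
  next
    case 3
    have pow: "k = 0" if "t ^ k \<noteq> t * t ^ (k - Suc 0)" for k
      using that by (cases k) auto
    have "((\<lambda>t. inverse t ^ n * exp (- inverse t)) has_real_derivative
        exp_bump (n + 2) t - real n * exp_bump (n + 1) t) (at t)"
      using 3
      by (cases n)
         (auto intro!: derivative_eq_intros simp: exp_bump_def power2_eq_square field_simps dest: pow)
    then show ?thesis
      by (rule has_field_derivative_transform_within_open[of _ _ _ "{0<..}"])
         (use 3 in \<open>auto simp: exp_bump_def\<close>)
  qed
qed

lemma smooth_on_exp_bump: "smooth_on UNIV (exp_bump n)"
proof -
  have "Ck_on k UNIV (exp_bump n)" for k
  proof (induction k arbitrary: n)
    case 0
    then show ?case
      using exp_bump_has_derivative by (auto intro!: continuous_at_imp_continuous_on DERIV_isCont)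
  next
    case (Suc k)
    show ?case
    proof (rule Ck_on_SucI)
      show "(exp_bump n has_derivative
          (\<lambda>v. exp_bump (n + 2) x * v + exp_bump (n + 1) x * (- real n * v))) (at x)" for x
        using exp_bump_has_derivative[of n x] unfolding has_field_derivative_def
        by (rule has_derivative_eq_rhs) (auto simp: algebra_simps)
      show "Ck_on k UNIV (\<lambda>x. exp_bump (n + 2) x * v + exp_bump (n + 1) x * (- real n * v))" for v
        by (rule Ck_on_add[OF open_UNIV Ck_on_bilinear[OF open_UNIV bounded_bilinear_mult Suc.IH Ck_on_const]
              Ck_on_bilinear[OF open_UNIV bounded_bilinear_mult Suc.IH Ck_on_const]])
    qed simp
  qed
  then show ?thesis by (simp add: smooth_on_def)
qed

text \<open>Composing \<open>exp_bump 0\<close> with e^2 - |x - x0|^2 gives a function that is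
  positive inside the ball and zero outside. The squared norm, written as an inner product, is
  smooth also at \<open>x0\<close>.\<close>

lemma smooth_bump_exists:
  fixes x0 :: "real ^ 'd"
  assumes "open S" "x0 \<in> S"
  obtains \<theta> :: "real ^ 'd \<Rightarrow> complex" and K
  where "smooth_on UNIV \<theta>" "\<theta> x0 \<noteq> 0" "compact K" "K \<subseteq> S" "\<And>x. x \<notin> K \<Longrightarrow> \<theta> x = 0"
proof -
  obtain e where e: "e > 0" "cball x0 e \<subseteq> S" using assms open_contains_cball by blast
  define \<theta> where "\<theta> x = complex_of_real (exp_bump 0 (e\<^sup>2 - (x - x0) \<bullet> (x - x0)))" for x
  have "smooth_on UNIV (\<lambda>x. x - x0)"
    using smooth_on_add[OF open_UNIV smooth_on_bounded_linear[OF open_UNIV bounded_linear_ident]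
        smooth_on_const[of _ "- x0"]] by simp
  then have "smooth_on UNIV (\<lambda>x. (x - x0) \<bullet> (x - x0))"
    by (simp add: smooth_on_def Ck_on_bilinear[OF open_UNIV bounded_bilinear_inner])
  then have "smooth_on UNIV (\<lambda>x. e\<^sup>2 + - ((x - x0) \<bullet> (x - x0)))"
    by (intro smooth_on_add[OF open_UNIV smooth_on_const]
        smooth_on_bounded_linear_compose[OF open_UNIV bounded_linear_minus[OF bounded_linear_ident]])
  then have "smooth_on UNIV (\<lambda>x. exp_bump 0 (e\<^sup>2 + - ((x - x0) \<bullet> (x - x0))))"
    by (rule smooth_on_compose[OF open_UNIV open_UNIV subset_UNIV _ smooth_on_exp_bump])
  then have "smooth_on UNIV \<theta>"
    unfolding \<theta>_def
    using smooth_on_bounded_linear_compose[OF open_UNIV bounded_linear_of_real] by fastforce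
  moreover have "\<theta> x = 0" if "x \<notin> cball x0 e" for x
  proof -
    have "e < norm (x - x0)" using that by (simp add: dist_norm norm_minus_commute)
    then have "e\<^sup>2 < (norm (x - x0))\<^sup>2" using e(1) by (intro power_strict_mono) auto
    then show ?thesis by (simp add: \<theta>_def exp_bump_def power2_norm_eq_inner)
  qed
  moreover have "\<theta> x0 \<noteq> 0" using e(1) by (simp add: \<theta>_def exp_bump_def)
  ultimately show ?thesis using that[of \<theta> "cball x0 e"] e(2) by auto
qed

lemma smooth_on_coordinate:
  fixes x0 :: "real ^ 'd"
  shows "smooth_on UNIV (\<lambda>x. complex_of_real ((x - x0) $ i))"
proof -
  have "bounded_linear (\<lambda>x :: real ^ 'd. complex_of_real (x $ i))"
    by (rule bounded_linear_compose[OF bounded_linear_of_real bounded_linear_vec_nth])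
  from smooth_on_add[OF open_UNIV smooth_on_bounded_linear[OF open_UNIV this]
      smooth_on_const[of _ "- complex_of_real (x0 $ i)"]]
  show ?thesis by simp
qed

lemma vanishes_to_order_coordinate_power:
  "vanishes_to_order n (\<lambda>x. complex_of_real ((x - x0) $ i) ^ n) x0"
proof (induction n)
  case (Suc n)
  have "vanishes_to_order (Suc n)
      (\<lambda>x. complex_of_real ((x - x0) $ i) ^ n * complex_of_real ((x - x0) $ i)) x0"
    by (rule vanishes_to_order_mult_Suc[OF open_UNIV UNIV_I
          smooth_on_power[OF open_UNIV smooth_on_coordinate] smooth_on_coordinate Suc]) simp
  then show ?case by (simp only: power_Suc2)
qed simp

text \<open>Every derivative multiplies by the current exponent and by \<open>z i\<close>; the free
  factor \<open>c\<close> absorbs these in the induction.\<close>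

lemma funpow_complex_derivative_coordinate_power:
  "(complex_derivative z ^^ n) (\<lambda>x. c * complex_of_real ((x - x0) $ i) ^ n) = (\<lambda>x. c * fact n * z i ^ n)"
proof (induction n arbitrary: c)
  case (Suc n)
  let ?l = "\<lambda>x :: real ^ 'a. complex_of_real ((x - x0) $ i)"
  have l: "(?l has_derivative (\<lambda>h. complex_of_real (h $ i))) (at x)" for x
    by (rule bounded_linear.has_derivative[OF bounded_linear_of_real])
       (auto intro!: derivative_eq_intros bounded_linear.has_derivative[OF bounded_linear_vec_nth])
  have *: "partial j (\<lambda>x. c * ?l x ^ Suc n) x = c * of_nat (Suc n) * ?l x ^ n * (if j = i then 1 else 0)" for j x
    by (subst partial_eqI[OF has_derivative_mult_right[OF has_derivative_power[OF l]]])
       (auto simp: axis_def)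
  have "complex_derivative z (\<lambda>x. c * ?l x ^ Suc n) x = (c * of_nat (Suc n) * z i) * ?l x ^ n" for x
  proof -
    have "complex_derivative z (\<lambda>x. c * ?l x ^ Suc n) x =
        (\<Sum>j\<in>UNIV. if j = i then z i * (c * of_nat (Suc n) * ?l x ^ n) else 0)"
      unfolding complex_derivative_def *
      by (intro sum.cong) auto
    then show ?thesis by simp
  qed
  then have "complex_derivative z (\<lambda>x. c * ?l x ^ Suc n) = (\<lambda>x. (c * of_nat (Suc n) * z i) * ?l x ^ n)"
    by blast
  then have "(complex_derivative z ^^ Suc n) (\<lambda>x. c * ?l x ^ Suc n) =
      (complex_derivative z ^^ n) (\<lambda>x. (c * of_nat (Suc n) * z i) * ?l x ^ n)"
    by (simp only: funpow_Suc_right o_apply)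
  also have "\<dots> = (\<lambda>x. (c * of_nat (Suc n) * z i) * fact n * z i ^ n)" by (rule Suc.IH)
  also have "\<dots> = (\<lambda>x. c * fact (Suc n) * z i ^ Suc n)"
    by (simp add: mult_ac)
  finally show ?case .
qed simp

subsection \<open>Functionals vanishing on a common kernel\<close>

definition function_space :: "('x \<Rightarrow> complex) set \<Rightarrow> bool" where
  "function_space E \<longleftrightarrow> 0 \<in> E \<and> (\<forall>v\<in>E. \<forall>w\<in>E. v + w \<in> E) \<and> (\<forall>a. \<forall>v\<in>E. (\<lambda>x. a * v x) \<in> E)"

definition linear_functional_on :: "('x \<Rightarrow> complex) set \<Rightarrow> (('x \<Rightarrow> complex) \<Rightarrow> complex) \<Rightarrow> bool" where
  "linear_functional_on E u \<longleftrightarrow>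
     (\<forall>v\<in>E. \<forall>w\<in>E. u (v + w) = u v + u w) \<and> (\<forall>a. \<forall>v\<in>E. u (\<lambda>x. a * v x) = a * u v)"

text \<open>Induction on the number of functionals. Either \<open>\<phi> j\<close> vanishes on the
  common kernel of the others and gets coefficient 0, or some \<open>g\<close> in that kernel has
  \<open>\<phi> j g \<noteq> 0\<close>, and subtracting the right multiple of
  \<open>\<phi> j\<close> from \<open>u\<close> reduces to the smaller family.\<close>

lemma functional_in_span_of_common_kernel:
  assumes "finite I" "function_space E" "\<And>i. i \<in> I \<Longrightarrow> linear_functional_on E (\<phi> i)"
    "linear_functional_on E u"
    "\<And>h. h \<in> E \<Longrightarrow> \<forall>i\<in>I. \<phi> i h = 0 \<Longrightarrow> u h = 0"
  shows "\<exists>a. \<forall>h\<in>E. u h = (\<Sum>i\<in>I. a i * \<phi> i h)"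
  using assms(1,3-)
proof (induction I arbitrary: u rule: finite_induct)
  case empty
  then show ?case by simp
next
  case (insert j I)
  note E = assms(2)[unfolded function_space_def] and lin = linear_functional_on_def
  show ?case
  proof (cases "\<forall>h\<in>E. (\<forall>i\<in>I. \<phi> i h = 0) \<longrightarrow> \<phi> j h = 0")
    case True
    have "\<exists>a. \<forall>h\<in>E. u h = (\<Sum>i\<in>I. a i * \<phi> i h)"
      by (rule insert.IH) (use insert.prems True in auto)
    then obtain a where a: "\<forall>h\<in>E. u h = (\<Sum>i\<in>I. a i * \<phi> i h)" ..
    then have "\<forall>h\<in>E. u h = (\<Sum>i\<in>insert j I. (a(j := 0)) i * \<phi> i h)"
      using insert.hyps by (auto intro!: sum.cong)
    then show ?thesis by blast
  next
    case False
    then obtain g where g: "g \<in> E" "\<forall>i\<in>I. \<phi> i g = 0" "\<phi> j g \<noteq> 0" by blast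
    define b where "b = u g / \<phi> j g"
    have u: "linear_functional_on E u" and \<phi>: "i \<in> insert j I \<Longrightarrow> linear_functional_on E (\<phi> i)" for i
      using insert.prems by auto
    have "\<exists>a. \<forall>h\<in>E. u h - b * \<phi> j h = (\<Sum>i\<in>I. a i * \<phi> i h)"
    proof (rule insert.IH)
      show "linear_functional_on E (\<lambda>h. u h - b * \<phi> j h)"
        using u \<phi>[of j] unfolding lin by (auto simp: algebra_simps)
      fix h assume h: "h \<in> E" "\<forall>i\<in>I. \<phi> i h = 0"
      \<comment> \<open>The projection of \<open>h\<close> along \<open>g\<close> into the kernel of
        \<open>\<phi> j\<close>; it stays in the kernels of the others because \<open>g\<close> lies
        there.\<close>
      define k where "k = h + (\<lambda>x. (- \<phi> j h / \<phi> j g) * g x)"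
      have mem: "(\<lambda>x. (- \<phi> j h / \<phi> j g) * g x) \<in> E" "k \<in> E"
        unfolding k_def using E g h by blast+
      have eval: "w k = w h + (- \<phi> j h / \<phi> j g) * w g" if "linear_functional_on E w" for w
        using that mem(1) h(1) g(1) unfolding k_def lin by metis
      have "u k = 0"
        by (rule insert.prems(3)[OF mem(2)]) (use eval[OF \<phi>] g h in auto)
      then show "u h - b * \<phi> j h = 0" using eval[OF u] by (simp add: b_def field_simps)
    qed (use insert.prems in auto)
    then obtain a where a: "\<forall>h\<in>E. u h - b * \<phi> j h = (\<Sum>i\<in>I. a i * \<phi> i h)" ..
    have "u h = (\<Sum>i\<in>insert j I. (a(j := b)) i * \<phi> i h)" if "h \<in> E" for h
    proof -
      have "(\<Sum>i\<in>I. (a(j := b)) i * \<phi> i h) = (\<Sum>i\<in>I. a i * \<phi> i h)"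
        using insert.hyps by (auto intro!: sum.cong)
      then show ?thesis using a that insert.hyps by (simp add: algebra_simps)
    qed
    then show ?thesis by blast
  qed
qed

subsection \<open>Smooth functions and maps in charts\<close>

lemma is_chartD:
  assumes "is_chart c"
  shows "open (fst c)" "open (snd c ` fst c)"
    "x \<in> fst c \<Longrightarrow> chart_inv c (snd c x) = x"
    "y \<in> snd c ` fst c \<Longrightarrow> chart_inv c y \<in> fst c"
    "y \<in> snd c ` fst c \<Longrightarrow> snd c (chart_inv c y) = y"
    "continuous_on (fst c) (snd c)" "continuous_on (snd c ` fst c) (chart_inv c)"
proof -
  have hom: "homeomorphism (fst c) (snd c ` fst c) (snd c) (chart_inv c)" and
    "open (fst c)" "open (snd c ` fst c)"
    using assms by (auto simp: is_chart_def)
  then show "open (fst c)" "open (snd c ` fst c)" by auto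
  show "x \<in> fst c \<Longrightarrow> chart_inv c (snd c x) = x" using hom by (rule homeomorphism_apply1)
  show "y \<in> snd c ` fst c \<Longrightarrow> chart_inv c y \<in> fst c" by (rule inv_into_into)
  show "y \<in> snd c ` fst c \<Longrightarrow> snd c (chart_inv c y) = y" by (rule f_inv_into_f)
  show "continuous_on (fst c) (snd c)" "continuous_on (snd c ` fst c) (chart_inv c)"
    using hom homeomorphism_cont1 homeomorphism_cont2 by blast+
qed

lemma open_chart_image:
  assumes "is_chart c" "open W" "W \<subseteq> fst c"
  shows "open (snd c ` W)"
proof -
  have "openin (top_of_set (snd c ` fst c)) (snd c ` W)"
    using assms homeomorphism_imp_open_map[of "fst c" "snd c ` fst c" "snd c" "chart_inv c" W]
    by (auto simp: is_chart_def openin_open)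
  then show ?thesis using is_chartD(2)[OF assms(1)] openin_open_eq by blast
qed

lemma smooth_structureD:
  assumes "smooth_structure A"
  shows "c \<in> A \<Longrightarrow> is_chart c" "\<exists>c\<in>A. x \<in> fst c"
    "c \<in> A \<Longrightarrow> c' \<in> A \<Longrightarrow> smooth_on (snd c ` (fst c \<inter> fst c')) (snd c' \<circ> chart_inv c)"
  using assms unfolding smooth_structure_def compatible_def by blast+

text \<open>Near each point a chart around its image is inserted, and smoothness is glued from the
  resulting neighbourhoods.\<close>

lemma smooth_functions_compose:
  assumes A: "smooth_structure A" and f: "smooth_map A f" and h: "h \<in> smooth_functions A"
  shows "h \<circ> f \<in> smooth_functions A"
  unfolding smooth_functions_def
proof (intro CollectI ballI smooth_on_local)
  fix c y assume c: "c \<in> A" and y: "y \<in> snd c ` fst c"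
  note ch = is_chartD[OF smooth_structureD(1)[OF A]]
  obtain c' where c': "c' \<in> A" "f (chart_inv c y) \<in> fst c'"
    using smooth_structureD(2)[OF A] by blast
  define W where "W = fst c \<inter> f -` fst c'"
  have "open (f -` fst c')"
    using f ch(1)[OF c'(1)] by (auto simp: smooth_map_def intro: open_vimage)
  then have W: "open W" "open (snd c ` W)"
    unfolding W_def using ch(1)[OF c] by (auto intro: open_chart_image[OF smooth_structureD(1)[OF A c]])
  have "smooth_on (snd c ` W) (\<lambda>y. (h \<circ> chart_inv c') ((snd c' \<circ> f \<circ> chart_inv c) y))"
  proof (rule smooth_on_compose[OF W(2) ch(2)[OF c'(1)]])
    show "smooth_on (snd c ` W) (snd c' \<circ> f \<circ> chart_inv c)"
      using f c c'(1) unfolding W_def smooth_map_def by blast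
    show "smooth_on (snd c' ` fst c') (h \<circ> chart_inv c')"
      using h c'(1) by (auto simp: smooth_functions_def)
  qed (auto simp: W_def ch(3)[OF c])
  then have "smooth_on (snd c ` W) (h \<circ> f \<circ> chart_inv c)"
    by (rule smooth_on_cong[OF W(2), rotated]) (auto simp: W_def ch(3)[OF c] ch(3)[OF c'(1)])
  moreover have "y \<in> snd c ` W"
    using y c' ch(3)[OF c] by (auto simp: W_def)
  ultimately show "\<exists>T. open T \<and> y \<in> T \<and> smooth_on T (h \<circ> f \<circ> chart_inv c)"
    using W(2) by blast
qed

lemma smooth_map_compose:
  assumes A: "smooth_structure A" and f: "smooth_map A f" and g: "smooth_map A g"
  shows "smooth_map A (f \<circ> g)"
  unfolding smooth_map_def
proof (intro conjI ballI smooth_on_local)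
  note ch = is_chartD[OF smooth_structureD(1)[OF A]]
  have cont: "continuous_on UNIV f" "continuous_on UNIV g"
    using f g by (auto simp: smooth_map_def)
  then show "continuous_on UNIV (f \<circ> g)"
    by (metis continuous_on_compose continuous_on_subset top_greatest)
  fix c c' y assume c: "c \<in> A" and c': "c' \<in> A" and y: "y \<in> snd c ` (fst c \<inter> (f \<circ> g) -` fst c')"
  obtain c'' where c'': "c'' \<in> A" "g (chart_inv c y) \<in> fst c''"
    using smooth_structureD(2)[OF A] by blast
  define W' where "W' = fst c'' \<inter> f -` fst c'"
  define W where "W = fst c \<inter> g -` W'"
  have W': "open W'" "open (snd c'' ` W')"
    unfolding W'_def using cont(1) ch(1)[OF c''(1)] ch(1)[OF c']
    by (auto intro!: open_chart_image[OF smooth_structureD(1)[OF A c''(1)]] open_Int intro: open_vimage)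
  have W: "open W" "open (snd c ` W)"
    unfolding W_def using cont(2) W'(1) ch(1)[OF c]
    by (auto intro!: open_chart_image[OF smooth_structureD(1)[OF A c]] open_Int intro: open_vimage)
  have "smooth_on (snd c ` W) (\<lambda>y. (snd c' \<circ> f \<circ> chart_inv c'') ((snd c'' \<circ> g \<circ> chart_inv c) y))"
  proof (rule smooth_on_compose[where f = "snd c'' \<circ> g \<circ> chart_inv c", OF W(2) W'(2)])
    have "smooth_on (snd c ` (fst c \<inter> g -` fst c'')) (snd c'' \<circ> g \<circ> chart_inv c)"
      using g c c''(1) unfolding smooth_map_def by blast
    then show "smooth_on (snd c ` W) (snd c'' \<circ> g \<circ> chart_inv c)"
      by (rule smooth_on_subset) (auto simp: W_def W'_def)
    show "smooth_on (snd c'' ` W') (snd c' \<circ> f \<circ> chart_inv c'')"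
      using f c' c''(1) unfolding W'_def smooth_map_def by blast
  qed (auto simp: W_def ch(3)[OF c])
  then have "smooth_on (snd c ` W) (snd c' \<circ> (f \<circ> g) \<circ> chart_inv c)"
    by (rule smooth_on_cong[OF W(2), rotated])
       (auto simp: W_def W'_def ch(3)[OF c] ch(3)[OF c''(1)])
  moreover have "y \<in> snd c ` W"
    using y c'' ch(3)[OF c] by (auto simp: W_def W'_def)
  ultimately show "\<exists>T. open T \<and> y \<in> T \<and> smooth_on T (snd c' \<circ> (f \<circ> g) \<circ> chart_inv c)"
    using W(2) by blast
qed

lemma smooth_map_funpow:
  assumes A: "smooth_structure A" and f: "smooth_map A f"
  shows "smooth_map A (f ^^ r)"
proof (induction r)
  case 0
  have "continuous_on UNIV (id :: 'a \<Rightarrow> 'a)" by (simp add: continuous_on_id)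
  \<comment> \<open>In charts the identity is a coordinate change, so the base case is the
    compatibility of the atlas.\<close>
  then show ?case
    using smooth_structureD(3)[OF A] by (auto simp: smooth_map_def o_def id_def)
next
  case (Suc r)
  then show ?case using smooth_map_compose[OF A f] by (simp only: funpow.simps)
qed

subsection \<open>The functionals supported at a point\<close>

lemma funpow_partial_add:
  assumes "open S" "smooth_on S f" "smooth_on S g" "x \<in> S"
  shows "(partial i ^^ n) (\<lambda>x. f x + g x) x = (partial i ^^ n) f x + (partial i ^^ n) g x"
  using assms(4)
proof (induction n arbitrary: x)
  case (Suc n)
  note sm = assms(2,3)[THEN smooth_on_funpow_partial, of n i]
  have "(partial i ^^ Suc n) (\<lambda>x. f x + g x) x =
      partial i (\<lambda>x. (partial i ^^ n) f x + (partial i ^^ n) g x) x"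
    using partial_cong[OF assms(1) Suc.prems Suc.IH smooth_on_differentiable[OF
        smooth_on_funpow_partial[OF smooth_on_add[OF assms(1-3)]] Suc.prems]] by simp
  then show ?case using partial_add[OF sm Suc.prems] by simp
qed simp

lemma funpow_partial_cmult:
  assumes "open S" "smooth_on S f" "x \<in> S"
  shows "(partial i ^^ n) (\<lambda>x. a * f x) x = a * (partial i ^^ n) f x"
  using assms(3)
proof (induction n arbitrary: x)
  case (Suc n)
  have "(partial i ^^ Suc n) (\<lambda>x. a * f x) x = partial i (\<lambda>x. a * (partial i ^^ n) f x) x"
    using partial_cong[OF assms(1) Suc.prems Suc.IH smooth_on_differentiable[OF
        smooth_on_funpow_partial[OF smooth_on_cmult[OF assms(1,2)]] Suc.prems]] by simp
  then show ?case
    using partial_cmult[OF smooth_on_funpow_partial[OF assms(2)] Suc.prems] by simp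
qed simp

lemma list_partial_add:
  assumes "open S" "smooth_on S f" "smooth_on S g" "x \<in> S"
  shows "list_partial is m (\<lambda>x. f x + g x) x = list_partial is m f x + list_partial is m g x"
  using assms(4)
proof (induction "is" arbitrary: x)
  case (Cons i "is")
  note sm = assms(2,3)[THEN smooth_on_list_partial, of "is" m]
  have "list_partial (i # is) m (\<lambda>x. f x + g x) x =
      (partial i ^^ m i) (\<lambda>x. list_partial is m f x + list_partial is m g x) x"
    using funpow_partial_cong[OF assms(1) smooth_on_list_partial[OF smooth_on_add[OF assms(1-3)]]
        Cons.IH Cons.prems] by simp
  then show ?case using funpow_partial_add[OF assms(1) sm Cons.prems] by simp
qed simp

lemma list_partial_cmult:
  assumes "open S" "smooth_on S f" "x \<in> S"
  shows "list_partial is m (\<lambda>x. a * f x) x = a * list_partial is m f x"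
  using assms(3)
proof (induction "is" arbitrary: x)
  case (Cons i "is")
  have "list_partial (i # is) m (\<lambda>x. a * f x) x = (partial i ^^ m i) (\<lambda>x. a * list_partial is m f x) x"
    using funpow_partial_cong[OF assms(1) smooth_on_list_partial[OF smooth_on_cmult[OF assms(1,2)]]
        Cons.IH Cons.prems] by simp
  then show ?case
    using funpow_partial_cmult[OF assms(1) smooth_on_list_partial[OF assms(2)] Cons.prems] by simp
qed simp

lemma multi_partial_add:
  assumes "open S" "smooth_on S f" "smooth_on S g" "x \<in> S"
  shows "multi_partial m (\<lambda>x. f x + g x) x = multi_partial m f x + multi_partial m g x"
  using multi_partial_eq_list_partial list_partial_add[OF assms] by metis

lemma multi_partial_cmult:
  assumes "open S" "smooth_on S f" "x \<in> S"
  shows "multi_partial m (\<lambda>x. a * f x) x = a * multi_partial m f x"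
  using multi_partial_eq_list_partial list_partial_cmult[OF assms] by metis

lemma charts_atD:
  assumes "smooth_structure A" "c \<in> charts_at A p"
  shows "c \<in> A" "p \<in> fst c" "is_chart c" "open (snd c ` fst c)" "snd c p \<in> snd c ` fst c"
    "chart_inv c (snd c p) = p"
proof -
  show c: "c \<in> A" "p \<in> fst c" using assms(2) by (auto simp: charts_at_def)
  show "is_chart c" using smooth_structureD(1)[OF assms(1) c(1)] .
  then show "open (snd c ` fst c)" "chart_inv c (snd c p) = p" using is_chartD c(2) by blast+
  show "snd c p \<in> snd c ` fst c" using c(2) by blast
qed

lemma smooth_functions_chart:
  "h \<in> smooth_functions A \<Longrightarrow> c \<in> A \<Longrightarrow> smooth_on (snd c ` fst c) (h \<circ> chart_inv c)"
  by (simp add: smooth_functions_def)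

lemma plus_comp: "(v + w) \<circ> k = (\<lambda>y. (v \<circ> k) y + (w \<circ> k) y)" for v w :: "'x \<Rightarrow> complex"
  by auto

lemma cmult_comp: "(\<lambda>x. a * v x) \<circ> k = (\<lambda>y. a * (v \<circ> k) y)" for v :: "'x \<Rightarrow> complex"
  by auto

lemma zero_comp: "(0 :: 'x \<Rightarrow> complex) \<circ> k = (\<lambda>y. 0)"
  by auto

lemma function_space_smooth_functions:
  assumes "smooth_structure A"
  shows "function_space (smooth_functions A)"
proof -
  have "open (snd c ` fst c)" if "c \<in> A" for c
    using is_chartD(2) smooth_structureD(1)[OF assms that] by blast
  then show ?thesis
    unfolding function_space_def smooth_functions_def
    by (auto simp only: plus_comp cmult_comp zero_comp mem_Collect_eq
        intro!: smooth_on_add smooth_on_cmult smooth_on_const)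
qed

lemma linear_functional_on_multi_partial:
  assumes "smooth_structure A" "c \<in> charts_at A p"
  shows "linear_functional_on (smooth_functions A) (\<lambda>h. multi_partial m (h \<circ> chart_inv c) (snd c p))"
proof -
  note ch = charts_atD[OF assms]
  show ?thesis
    unfolding linear_functional_on_def plus_comp cmult_comp
    by (intro conjI ballI allI multi_partial_add[OF ch(4) _ _ ch(5)] multi_partial_cmult[OF ch(4) _ ch(5)]
        smooth_functions_chart[OF _ ch(1)])
qed

lemma linear_functional_on_subset:
  "linear_functional_on E u \<Longrightarrow> V \<subseteq> E \<Longrightarrow> linear_functional_on V u"
  unfolding linear_functional_on_def by blast

lemma finite_multi_indices: "finite {m :: 'd::finite \<Rightarrow> nat. (\<Sum>i\<in>UNIV. m i) < n}"
proof (rule finite_subset)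
  show "{m :: 'd \<Rightarrow> nat. (\<Sum>i\<in>UNIV. m i) < n} \<subseteq> UNIV \<rightarrow>\<^sub>E {..<n}"
  proof
    fix m :: "'d \<Rightarrow> nat" assume m: "m \<in> {m. (\<Sum>i\<in>UNIV. m i) < n}"
    have "m i < n" for i
      using m member_le_sum[of i UNIV m] by auto
    then show "m \<in> UNIV \<rightarrow>\<^sub>E {..<n}" by auto
  qed
qed (auto intro: finite_PiE)

section \<open>Operators of bounded order and their annihilators\<close>

lemma point_ops_vanish:
  assumes A: "smooth_structure A" and c: "c \<in> charts_at A p"
    and u: "u \<in> point_ops A p c (int n - 1)"
    and h: "h \<in> smooth_functions A" "vanishes_to_order n (h \<circ> chart_inv c) (snd c p)"
  shows "u h = 0"
proof -
  note ch = charts_atD[OF A c]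
  obtain D where D: "u = delta A p c D" "D \<in> diff_ops_upto (int n - 1)"
    using u by (auto simp: point_ops_def)
  have "multi_partial m (h \<circ> chart_inv c) (snd c p) = 0" if "m \<in> Poly_Mapping.keys D" for m
  proof -
    have "int (\<Sum>i\<in>UNIV. m i) \<le> int n - 1" using D(2) that by (auto simp: diff_ops_upto_def)
    then have "(\<Sum>i\<in>UNIV. m i) < n" by linarith
    then show ?thesis
      using h vanishes_to_order_iff_multi_partial[OF ch(4,5) smooth_functions_chart[OF h(1) ch(1)]]
      by blast
  qed
  then show ?thesis using h by (simp add: D delta_def apply_diff_op_def)
qed

lemma point_ops_linear:
  assumes A: "smooth_structure A" and c: "c \<in> charts_at A p" and u: "u \<in> point_ops A p c k"
  shows "linear_functional_on (smooth_functions A) u" "h \<notin> smooth_functions A \<Longrightarrow> u h = 0"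
proof -
  obtain D where D: "u = delta A p c D"
    using u by (auto simp: point_ops_def)
  show "h \<notin> smooth_functions A \<Longrightarrow> u h = 0" by (simp add: D delta_def)
  note E = function_space_smooth_functions[OF A, unfolded function_space_def]
  have lin: "multi_partial m ((v + w) \<circ> chart_inv c) (snd c p) =
      multi_partial m (v \<circ> chart_inv c) (snd c p) + multi_partial m (w \<circ> chart_inv c) (snd c p)"
    "multi_partial m ((\<lambda>x. a * v x) \<circ> chart_inv c) (snd c p) = a * multi_partial m (v \<circ> chart_inv c) (snd c p)"
    if "v \<in> smooth_functions A" "w \<in> smooth_functions A" for v w a m
    using linear_functional_on_multi_partial[OF A c, of m] that
    unfolding linear_functional_on_def by blast+
  show "linear_functional_on (smooth_functions A) u"
    unfolding linear_functional_on_def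
  proof (intro conjI ballI allI)
    fix v w assume "v \<in> smooth_functions A" "w \<in> smooth_functions A"
    then show "u (v + w) = u v + u w"
      using E by (simp add: D delta_def apply_diff_op_def lin distrib_left sum.distrib)
  next
    fix a v assume "v \<in> smooth_functions A"
    then show "u (\<lambda>x. a * v x) = a * u v"
      using E by (simp add: D delta_def apply_diff_op_def lin sum_distrib_left mult_ac)
  qed
qed

text \<open>The functions of \<open>V\<close> vanishing to order \<open>n\<close> form the common
  kernel of the finitely many derivatives of order below \<open>n\<close>, so duality writes
  \<open>u\<close> as their combination. The operator \<open>d\<close> acts on all smooth functions,
  but agreement with \<open>u\<close> is claimed on \<open>V\<close> only.\<close>

lemma functional_in_restriction_point_ops:
  assumes A: "smooth_structure A" and c: "c \<in> charts_at A p"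
    and V: "function_space V" "V \<subseteq> smooth_functions A"
    and u: "linear_functional_on V u"
    and vanish: "\<And>h. h \<in> V \<Longrightarrow> vanishes_to_order n (h \<circ> chart_inv c) (snd c p) \<Longrightarrow> u h = 0"
  shows "\<exists>d\<in>point_ops A p c (int n - 1). \<forall>h\<in>V. u h = d h"
proof -
  note ch = charts_atD[OF A c]
  define I where "I = {m :: 'b \<Rightarrow> nat. (\<Sum>i\<in>UNIV. m i) < n}"
  define \<phi> where "\<phi> m h = multi_partial m (h \<circ> chart_inv c) (snd c p)" for m h
  have "finite I" unfolding I_def by (rule finite_multi_indices)
  have "\<exists>a. \<forall>h\<in>V. u h = (\<Sum>m\<in>I. a m * \<phi> m h)"
  proof (rule functional_in_span_of_common_kernel[OF \<open>finite I\<close> V(1) _ u])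
    show "linear_functional_on V (\<phi> m)" for m
      unfolding \<phi>_def
      by (rule linear_functional_on_subset[OF linear_functional_on_multi_partial[OF A c] V(2)])
    fix h assume h: "h \<in> V" "\<forall>m\<in>I. \<phi> m h = 0"
    then have "smooth_on (snd c ` fst c) (h \<circ> chart_inv c)"
      using V(2) smooth_functions_chart ch(1) by blast
    then have "vanishes_to_order n (h \<circ> chart_inv c) (snd c p)"
      using h vanishes_to_order_iff_multi_partial[OF ch(4,5)] by (auto simp: I_def \<phi>_def)
    then show "u h = 0" using vanish h(1) by blast
  qed
  then obtain a where a: "\<forall>h\<in>V. u h = (\<Sum>m\<in>I. a m * \<phi> m h)" ..
  \<comment> \<open>Cutting the coefficients off outside \<open>I\<close> makes the support finite.
    Some may vanish inside, so \<open>keys D\<close> is only contained in \<open>I\<close>.\<close>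
  define D where "D = Abs_poly_mapping (\<lambda>m. if m \<in> I then a m else 0)"
  have lookup: "Poly_Mapping.lookup D = (\<lambda>m. if m \<in> I then a m else 0)"
    unfolding D_def by (rule lookup_Abs_poly_mapping) (simp add: \<open>finite I\<close>)
  have keys: "Poly_Mapping.keys D \<subseteq> I"
    by (auto simp: in_keys_iff lookup split: if_splits)
  have "delta A p c D h = u h" if h: "h \<in> V" for h
  proof -
    have "delta A p c D h = (\<Sum>m\<in>Poly_Mapping.keys D. Poly_Mapping.lookup D m * \<phi> m h)"
      using h V(2) by (auto simp: delta_def apply_diff_op_def \<phi>_def)
    also have "\<dots> = (\<Sum>m\<in>I. Poly_Mapping.lookup D m * \<phi> m h)"
      by (rule sum.mono_neutral_left[OF \<open>finite I\<close> keys]) (auto simp: in_keys_iff)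
    also have "\<dots> = u h" using a h by (simp add: lookup)
    finally show ?thesis .
  qed
  moreover have "delta A p c D \<in> point_ops A p c (int n - 1)"
    unfolding point_ops_def
  proof (rule imageI)
    have "int (\<Sum>i\<in>UNIV. m i) \<le> int n - 1" if "m \<in> Poly_Mapping.keys D" for m
    proof -
      have "(\<Sum>i\<in>UNIV. m i) < n" using keys that by (auto simp: I_def)
      then show ?thesis by linarith
    qed
    then show "D \<in> diff_ops_upto (int n - 1)" by (simp add: diff_ops_upto_def)
  qed
  ultimately show ?thesis by (intro bexI[of _ "delta A p c D"]) auto
qed

text \<open>Replaces an existence statement about coefficients by conditions linear in
  \<open>u\<close>. The bound \<open>int n - 1\<close> lets \<open>n = 0\<close> cover order -1,
  where only the zero functional remains.\<close>

lemma point_ops_iff: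
  assumes A: "smooth_structure A" and c: "c \<in> charts_at A p"
  shows "u \<in> point_ops A p c (int n - 1) \<longleftrightarrow>
    linear_functional_on (smooth_functions A) u \<and> (\<forall>h. h \<notin> smooth_functions A \<longrightarrow> u h = 0) \<and>
    (\<forall>h\<in>smooth_functions A. vanishes_to_order n (h \<circ> chart_inv c) (snd c p) \<longrightarrow> u h = 0)"
    (is "_ \<longleftrightarrow> ?R")
proof
  assume "u \<in> point_ops A p c (int n - 1)"
  then show ?R using point_ops_vanish[OF A c] point_ops_linear[OF A c] by blast
next
  assume R: ?R
  then obtain d where d: "d \<in> point_ops A p c (int n - 1)" "\<forall>h\<in>smooth_functions A. u h = d h"
    using functional_in_restriction_point_ops[OF A c function_space_smooth_functions[OF A] subset_refl]
    by blast
  have "u = d"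
    using d R point_ops_linear(2)[OF A c d(1)] by (intro ext) metis
  then show "u \<in> point_ops A p c (int n - 1)" using d by simp
qed

text \<open>The annihilator description is linear in the functional, so no sums of operators have to
  be formed.\<close>

lemma point_ops_subspace:
  assumes A: "smooth_structure A" and c: "c \<in> charts_at A p"
  shows "0 \<in> point_ops A p c (int n - 1)"
    "u \<in> point_ops A p c (int n - 1) \<Longrightarrow> w \<in> point_ops A p c (int n - 1) \<Longrightarrow>
      u + w \<in> point_ops A p c (int n - 1)"
    "u \<in> point_ops A p c (int n - 1) \<Longrightarrow> w \<in> point_ops A p c (int n - 1) \<Longrightarrow>
      u - w \<in> point_ops A p c (int n - 1)"
  unfolding point_ops_iff[OF A c] linear_functional_on_def by (auto simp: algebra_simps)

subsection \<open>Test functions\<close>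

text \<open>Two kinds of points: in the domain of \<open>c\<close> the function is \<open>k\<close>
  after a coordinate change; elsewhere it is zero on a neighbourhood that avoids the compact
  support.\<close>

lemma smooth_extension_by_zero:
  assumes A: "smooth_structure A" and c: "c \<in> A"
    and k: "smooth_on UNIV k" "compact K" "K \<subseteq> snd c ` fst c" "\<And>y. y \<notin> K \<Longrightarrow> k y = 0"
  shows "(\<lambda>x. if x \<in> fst c then k (snd c x) else 0) \<in> smooth_functions A" (is "?h \<in> _")
  unfolding smooth_functions_def
proof (intro CollectI ballI smooth_on_local)
  fix c' y assume c': "c' \<in> A" and y: "y \<in> snd c' ` fst c'"
  note ch = is_chartD[OF smooth_structureD(1)[OF A]]
  show "\<exists>T. open T \<and> y \<in> T \<and> smooth_on T (?h \<circ> chart_inv c')"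
  proof (cases "chart_inv c' y \<in> fst c")
    case True
    define W where "W = fst c' \<inter> fst c"
    have W: "open (snd c' ` W)"
      unfolding W_def using ch(1)[OF c] ch(1)[OF c']
      by (intro open_chart_image[OF smooth_structureD(1)[OF A c']]) auto
    have "smooth_on (snd c' ` W) (\<lambda>y. k ((snd c \<circ> chart_inv c') y))"
      using smooth_structureD(3)[OF A c' c] unfolding W_def[symmetric]
      by (rule smooth_on_compose[OF W open_UNIV subset_UNIV _ k(1)])
    then have "smooth_on (snd c' ` W) (?h \<circ> chart_inv c')"
      by (rule smooth_on_cong[OF W, rotated]) (auto simp: W_def ch(3)[OF c'])
    moreover have "y \<in> snd c' ` W"
      using True y ch(3)[OF c'] by (auto simp: W_def)
    ultimately show ?thesis using W by blast
  next
    case False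
    define W where "W = fst c' - chart_inv c ` K"
    have "compact (chart_inv c ` K)"
      using k(2,3) continuous_on_subset[OF ch(7)[OF c]] by (intro compact_continuous_image) auto
    \<comment> \<open>The Hausdorff property enters here: the compact support is closed in the
      manifold.\<close>
    then have "open W" unfolding W_def using ch(1)[OF c'] compact_imp_closed by blast
    then have W: "open (snd c' ` W)"
      by (intro open_chart_image[OF smooth_structureD(1)[OF A c']]) (auto simp: W_def)
    have "k (snd c x) = 0" if "x \<in> W" "x \<in> fst c" for x
      using that k(4) ch(3)[OF c] by (force simp: W_def)
    then have "smooth_on (snd c' ` W) (?h \<circ> chart_inv c')"
      by (intro smooth_on_cong[OF W _ smooth_on_const[of _ 0]]) (auto simp: W_def ch(3)[OF c'])
    moreover have "chart_inv c' y \<in> W"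
      using False y k(3) ch(4)[OF c] ch(3)[OF c'] by (auto simp: W_def)
    then have "y \<in> snd c' ` W"
      using y ch(5)[OF c'] by (metis imageI)
    ultimately show ?thesis using W by blast
  qed
qed

text \<open>The n-th power of the coordinate with \<open>z i \<noteq> 0\<close>, cut off by a bump
  function \<theta>. The value is n! times \<open>z i ^ n\<close> times the value of \<theta> at the
  centre, all of them nonzero.\<close>

lemma test_function_exists:
  assumes A: "smooth_structure A" and c: "c \<in> charts_at A p" and z: "z i \<noteq> 0"
  shows "\<exists>h\<in>smooth_functions A. vanishes_to_order n (h \<circ> chart_inv c) (snd c p) \<and>
    (complex_derivative z ^^ n) (h \<circ> chart_inv c) (snd c p) \<noteq> 0"
proof -
  note ch = charts_atD[OF A c]
  obtain \<theta> :: "real ^ 'b \<Rightarrow> complex" and K where \<theta>: "smooth_on UNIV \<theta>" "\<theta> (snd c p) \<noteq> 0"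
    "compact K" "K \<subseteq> snd c ` fst c" "\<And>x. x \<notin> K \<Longrightarrow> \<theta> x = 0"
    using smooth_bump_exists[OF ch(4,5)] by blast
  define l where "l x = complex_of_real ((x - snd c p) $ i) ^ n" for x
  define k where "k x = l x * \<theta> x" for x
  define h where "h x = (if x \<in> fst c then k (snd c x) else 0)" for x
  have l: "smooth_on UNIV l" unfolding l_def by (intro smooth_on_power smooth_on_coordinate) simp
  have k: "smooth_on UNIV k" unfolding k_def by (intro smooth_on_mult l \<theta>) simp
  have van: "vanishes_to_order n l (snd c p)"
    unfolding l_def by (rule vanishes_to_order_coordinate_power)
  have hk: "k y = (h \<circ> chart_inv c) y" if "y \<in> snd c ` fst c" for y
    using is_chartD(4,5)[OF ch(3) that] by (simp add: h_def)
  note ks = smooth_on_subset[OF k subset_UNIV]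
  have "h \<in> smooth_functions A"
    unfolding h_def by (rule smooth_extension_by_zero[OF A ch(1) k \<theta>(3,4)]) (simp add: k_def \<theta>(5))
  moreover have "vanishes_to_order n (h \<circ> chart_inv c) (snd c p)"
    by (rule vanishes_to_order_cong[OF ch(4,5) ks hk])
       (auto simp: k_def intro: vanishes_to_order_mult[OF open_UNIV UNIV_I l \<theta>(1) van])
  moreover have "(complex_derivative z ^^ n) (h \<circ> chart_inv c) (snd c p) = fact n * z i ^ n * \<theta> (snd c p)"
  proof -
    have "(complex_derivative z ^^ n) (h \<circ> chart_inv c) (snd c p) = (complex_derivative z ^^ n) k (snd c p)"
      by (rule funpow_complex_derivative_cong[OF ch(4,5) ks hk, symmetric])
    also have "\<dots> = (complex_derivative z ^^ n) l (snd c p) * \<theta> (snd c p)"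
      unfolding k_def by (rule funpow_complex_derivative_mult[OF open_UNIV UNIV_I l \<theta>(1) van])
    also have "(complex_derivative z ^^ n) l = (\<lambda>x. fact n * z i ^ n)"
      using funpow_complex_derivative_coordinate_power[of n z 1 "snd c p" i]
      unfolding l_def mult_1_left .
    finally show ?thesis .
  qed
  ultimately show ?thesis using z \<theta>(2) by (intro bexI[of _ h]) auto
qed

subsection \<open>Composition with a map fixing the point\<close>

text \<open>\<open>g\<close> need not map the chart domain into itself, so its coordinate expression
  \<open>G\<close> is considered on the part \<open>T\<close> that returns to the chart;
  \<open>g p = p\<close> puts the base point in \<open>T\<close>.\<close>

lemma chart_expression:
  assumes A: "smooth_structure A" and c: "c \<in> charts_at A p" and g: "smooth_map A g" "g p = p"
  defines "T \<equiv> snd c ` (fst c \<inter> g -` fst c)" and "G \<equiv> snd c \<circ> g \<circ> chart_inv c"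
  shows "open T" "snd c p \<in> T" "smooth_on T G" "G ` T \<subseteq> snd c ` fst c" "G (snd c p) = snd c p"
    "y \<in> T \<Longrightarrow> (h \<circ> chart_inv c) (G y) = (h \<circ> g \<circ> chart_inv c) y"
proof -
  note ch = charts_atD[OF A c] and chD = is_chartD[OF charts_atD(3)[OF A c]]
  have "open (g -` fst c)" using g(1) chD(1) by (auto simp: smooth_map_def intro: open_vimage)
  then show "open T"
    unfolding T_def using chD(1) by (intro open_chart_image[OF ch(3)]) auto
  show "snd c p \<in> T" using ch(2) g(2) by (auto simp: T_def)
  show "smooth_on T G" unfolding T_def G_def using g(1) ch(1) by (auto simp: smooth_map_def)
  show "G ` T \<subseteq> snd c ` fst c" by (auto simp: T_def G_def chD(3))
  show "G (snd c p) = snd c p" by (simp add: G_def ch(6) g(2))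
  show "y \<in> T \<Longrightarrow> (h \<circ> chart_inv c) (G y) = (h \<circ> g \<circ> chart_inv c) y"
    by (auto simp: T_def G_def chD(3))
qed

lemma vanishes_to_order_compose_map:
  assumes A: "smooth_structure A" and c: "c \<in> charts_at A p" and g: "smooth_map A g" "g p = p"
    and h: "h \<in> smooth_functions A" "vanishes_to_order n (h \<circ> chart_inv c) (snd c p)"
  shows "vanishes_to_order n (h \<circ> g \<circ> chart_inv c) (snd c p)"
proof -
  note ch = charts_atD[OF A c] and G = chart_expression[OF A c g]
  note sm = smooth_functions_chart[OF h(1) ch(1)]
  show ?thesis
  proof (rule vanishes_to_order_cong[OF G(1,2)])
    show "smooth_on (snd c ` (fst c \<inter> g -` fst c)) (\<lambda>y. (h \<circ> chart_inv c) ((snd c \<circ> g \<circ> chart_inv c) y))"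
      by (rule smooth_on_compose[OF G(1) ch(4) G(4,3) sm])
    show "vanishes_to_order n (\<lambda>y. (h \<circ> chart_inv c) ((snd c \<circ> g \<circ> chart_inv c) y)) (snd c p)"
      by (rule vanishes_to_order_compose[OF ch(4) G(1) sm G(3,4,2)]) (simp only: G(5) h(2))
  qed (rule G(6))
qed

lemma funpow_complex_derivative_compose_map:
  assumes A: "smooth_structure A" and c: "c \<in> charts_at A p" and g: "smooth_map A g" "g p = p"
    and h: "h \<in> smooth_functions A" "vanishes_to_order n (h \<circ> chart_inv c) (snd c p)"
    and eigen: "\<And>j. (\<Sum>i\<in>UNIV. z i * of_real
      (frechet_derivative (snd c \<circ> g \<circ> chart_inv c) (at (snd c p)) (axis i 1) $ j)) = \<alpha> * z j"
  shows "(complex_derivative z ^^ n) (h \<circ> g \<circ> chart_inv c) (snd c p) =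
    \<alpha> ^ n * (complex_derivative z ^^ n) (h \<circ> chart_inv c) (snd c p)"
proof -
  note ch = charts_atD[OF A c] and G = chart_expression[OF A c g]
  note sm = smooth_functions_chart[OF h(1) ch(1)]
  have "(complex_derivative z ^^ n) (h \<circ> g \<circ> chart_inv c) (snd c p) =
      (complex_derivative z ^^ n) (\<lambda>y. (h \<circ> chart_inv c) ((snd c \<circ> g \<circ> chart_inv c) y)) (snd c p)"
    by (rule funpow_complex_derivative_cong[OF G(1,2) smooth_on_compose[OF G(1) ch(4) G(4,3) sm] G(6),
          symmetric])
  also have "\<dots> = \<alpha> ^ n * (complex_derivative z ^^ n) (h \<circ> chart_inv c) ((snd c \<circ> g \<circ> chart_inv c) (snd c p))"
    by (rule funpow_complex_derivative_compose[OF ch(4) G(1) sm G(3,4,2) _ eigen]) (simp only: G(5) h(2))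
  finally show ?thesis by (simp only: G(5))
qed

section \<open>Tangent vectors and the differential in a chart\<close>

lemma tangent_spaceD:
  assumes "v \<in> tangent_space A p"
  shows "c \<notin> charts_at A p \<Longrightarrow> v c = 0"
    "c \<in> charts_at A p \<Longrightarrow> c' \<in> charts_at A p \<Longrightarrow>
      v c' = frechet_derivative (snd c' \<circ> chart_inv c) (at (snd c p)) (v c)"
  using assms unfolding tangent_space_def by blast+

text \<open>The definition evaluates in an arbitrarily chosen chart \<open>c0\<close>. The
  transformation law of \<open>v\<close> and the chain rule for the coordinate change cancel that
  choice.\<close>

lemma differential_chart:
  assumes A: "smooth_structure A" and c: "c \<in> charts_at A p" and g: "smooth_map A g" "g p = p"
    and v: "v \<in> tangent_space A p"
  shows "differential A g p v c =
    frechet_derivative (snd c \<circ> g \<circ> chart_inv c) (at (snd c p)) (v c)"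
proof -
  define c0 where "c0 = (SOME c. c \<in> charts_at A p)"
  have c0: "c0 \<in> charts_at A p" unfolding c0_def using c by (rule someI)
  note ch = charts_atD[OF A c] and ch0 = charts_atD[OF A c0]
  note chD = is_chartD[OF ch(3)] and chD0 = is_chartD[OF ch0(3)]
  let ?\<tau> = "snd c0 \<circ> chart_inv c" and ?G = "snd c \<circ> g \<circ> chart_inv c" and ?H = "snd c \<circ> g \<circ> chart_inv c0"
  have x0: "?\<tau> (snd c p) = snd c0 p" by (simp add: ch(6))
  have v0: "v c0 = frechet_derivative ?\<tau> (at (snd c p)) (v c)"
    using tangent_spaceD(2)[OF v c c0] .
  have \<tau>: "?\<tau> differentiable (at (snd c p))"
    using smooth_on_differentiable[OF smooth_structureD(3)[OF A ch(1) ch0(1)]] ch(2) ch0(2) by blast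
  have H: "?H differentiable (at (?\<tau> (snd c p)))"
  proof -
    have "smooth_on (snd c0 ` (fst c0 \<inter> g -` fst c)) ?H"
      using g(1) ch(1) ch0(1) by (auto simp: smooth_map_def)
    then show ?thesis
      unfolding x0 by (rule smooth_on_differentiable) (use ch(2) ch0(2) g(2) in auto)
  qed
  have "frechet_derivative (?H \<circ> ?\<tau>) (at (snd c p)) = frechet_derivative ?G (at (snd c p))"
  proof (rule frechet_derivative_transform_within_open)
    show "(?H \<circ> ?\<tau>) differentiable (at (snd c p))"
      by (rule differentiable_chain_at[OF \<tau> H])
    show "open (snd c ` (fst c \<inter> fst c0))"
      by (rule open_chart_image[OF ch(3)]) (use chD(1) chD0(1) in auto)
    show "snd c p \<in> snd c ` (fst c \<inter> fst c0)" using ch(2) ch0(2) by blast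
  qed (auto simp: chD(3) chD0(3))
  also have "frechet_derivative (?H \<circ> ?\<tau>) (at (snd c p)) =
      frechet_derivative ?H (at (snd c0 p)) \<circ> frechet_derivative ?\<tau> (at (snd c p))"
    using frechet_derivative_compose[OF \<tau> H] by (simp only: x0)
  finally have "frechet_derivative ?H (at (snd c0 p)) (v c0) = frechet_derivative ?G (at (snd c p)) (v c)"
    unfolding v0 by (metis comp_apply)
  then show ?thesis
    using c g(2) by (simp add: differential_def Let_def c0_def[symmetric])
qed

lemma tangent_vector_eq_0:
  assumes A: "smooth_structure A" and c: "c \<in> charts_at A p"
    and v: "v \<in> tangent_space A p" "v c = 0"
  shows "v = 0"
proof
  fix c'
  show "v c' = 0 c'"
  proof (cases "c' \<in> charts_at A p")
    case True
    have "(snd c' \<circ> chart_inv c) differentiable (at (snd c p))"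
      using smooth_on_differentiable[OF smooth_structureD(3)[OF A]] c True by (auto simp: charts_at_def)
    then have "frechet_derivative (snd c' \<circ> chart_inv c) (at (snd c p)) 0 = 0"
      using linear_frechet_derivative linear_0 by blast
    then show ?thesis using tangent_spaceD(2)[OF v(1) c True] v(2) by simp
  next
    case False
    then show ?thesis using tangent_spaceD(1)[OF v(1)] by simp
  qed
qed

text \<open>The vector is v + i w read in the chart: the two real equations defining a complex
  eigenvalue are the real and imaginary parts of the one stated. It is nonzero because a tangent
  vector is determined by its coordinates in one chart.\<close>

lemma complex_eigenvector_in_chart:
  assumes A: "smooth_structure A" and c: "c \<in> charts_at A p" and g: "smooth_map A g" "g p = p"
    and eigen: "complex_eigenvalue (tangent_space A p) (differential A g p) \<alpha>"
  obtains z i where "z i \<noteq> 0"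
    "\<And>j. (\<Sum>i\<in>UNIV. z i * of_real
      (frechet_derivative (snd c \<circ> g \<circ> chart_inv c) (at (snd c p)) (axis i 1) $ j)) = \<alpha> * z j"
proof -
  let ?L = "frechet_derivative (snd c \<circ> g \<circ> chart_inv c) (at (snd c p))"
  obtain v w where vw: "v \<in> tangent_space A p" "w \<in> tangent_space A p" "v \<noteq> 0 \<or> w \<noteq> 0"
    "differential A g p v = (\<lambda>c. Re \<alpha> *\<^sub>R v c - Im \<alpha> *\<^sub>R w c)"
    "differential A g p w = (\<lambda>c. Im \<alpha> *\<^sub>R v c + Re \<alpha> *\<^sub>R w c)"
    using eigen unfolding complex_eigenvalue_def by blast
  have Lv: "?L (v c) = Re \<alpha> *\<^sub>R v c - Im \<alpha> *\<^sub>R w c" and Lw: "?L (w c) = Im \<alpha> *\<^sub>R v c + Re \<alpha> *\<^sub>R w c"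
    using differential_chart[OF A c g vw(1)] differential_chart[OF A c g vw(2)] vw(4,5) by simp_all
  have lin: "linear ?L"
    by (intro linear_frechet_derivative smooth_on_differentiable[OF chart_expression(3,2)[OF A c g]])
  have expand: "?L u $ j = (\<Sum>i\<in>UNIV. u $ i * ?L (axis i 1) $ j)" for u j
  proof -
    have "?L u = ?L (\<Sum>i\<in>UNIV. (u $ i) *\<^sub>R axis i 1)"
      by (simp add: basis_expansion scalar_mult_eq_scaleR[symmetric])
    also have "\<dots> = (\<Sum>i\<in>UNIV. (u $ i) *\<^sub>R ?L (axis i 1))"
      using lin by (simp add: linear_sum linear_cmul)
    finally show ?thesis by simp
  qed
  define z where "z i = Complex (v c $ i) (w c $ i)" for i
  have "v c \<noteq> 0 \<or> w c \<noteq> 0" using tangent_vector_eq_0[OF A c] vw by blast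
  then obtain i where "z i \<noteq> 0" by (auto simp: z_def vec_eq_iff complex_eq_iff)
  moreover have "(\<Sum>i\<in>UNIV. z i * of_real (?L (axis i 1) $ j)) = \<alpha> * z j" for j
  proof (rule complex_eqI)
    show "Re (\<Sum>i\<in>UNIV. z i * of_real (?L (axis i 1) $ j)) = Re (\<alpha> * z j)"
      using expand[of "v c" j] by (simp add: z_def Lv)
    show "Im (\<Sum>i\<in>UNIV. z i * of_real (?L (axis i 1) $ j)) = Im (\<alpha> * z j)"
      using expand[of "w c" j] by (simp add: z_def Lw)
  qed
  ultimately show ?thesis using that by blast
qed

subsection \<open>Boundedness\<close>

lemma quasi_banach_spaceD:
  assumes "quasi_banach_space V N"
  shows "function_space V" "v \<in> V \<Longrightarrow> N v \<ge> 0" "v \<in> V \<Longrightarrow> N (\<lambda>x. a * v x) = cmod a * N v"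
    "v \<in> V \<Longrightarrow> N v = 0 \<Longrightarrow> v = 0"
  using assms by (simp_all add: quasi_banach_space_def quasi_norm_on_def function_space_def)

text \<open>Continuity of the inclusion at 0 gives a quasi-norm ball on which the functional is
  smaller than 1; homogeneity of both sides turns this into a linear bound.\<close>

lemma multi_partial_bounded_on:
  assumes A: "smooth_structure A" and c: "c \<in> charts_at A p"
    and qb: "quasi_banach_space V N" and V: "V \<subseteq> smooth_functions A"
    and inclusion: "continuous_map (quasi_norm_topology V N) (whitney_topology A) (\<lambda>h. h)"
  shows "\<exists>B. \<forall>h\<in>V. cmod (multi_partial m (h \<circ> chart_inv c) (snd c p)) \<le> B * N h"
proof -
  note ch = charts_atD[OF A c] and Q = quasi_banach_spaceD[OF qb]
  define \<phi> where "\<phi> h = multi_partial m (h \<circ> chart_inv c) (snd c p)" for h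
  have lin: "linear_functional_on V \<phi>"
    unfolding \<phi>_def by (rule linear_functional_on_subset[OF linear_functional_on_multi_partial[OF A c] V])
  have zero: "0 \<in> V" and scale: "\<And>a v. v \<in> V \<Longrightarrow> (\<lambda>x. a * v x) \<in> V"
    using Q(1) by (auto simp: function_space_def)
  \<comment> \<open>A generating Whitney neighbourhood of 0 for a one-point compact set;
    \<open>h - 0\<close> keeps the shape of the generators.\<close>
  define O' where "O' = {h \<in> smooth_functions A.
    \<forall>y\<in>{snd c p}. cmod (multi_partial m ((h - 0) \<circ> chart_inv c) y) < 1}"
  have "openin (whitney_topology A) O'"
    unfolding whitney_topology_def
  proof (rule topology_generated_by_Basis, rule insertI2)
    have "(0 :: 'a \<Rightarrow> complex) \<in> smooth_functions A \<and> c \<in> A \<and> compact {snd c p} \<and>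
        {snd c p} \<subseteq> snd c ` fst c \<and> (1 :: real) > 0"
      using zero V ch by auto
    then show "O' \<in> {{h \<in> smooth_functions A. \<forall>y\<in>K. cmod (multi_partial m ((h - g) \<circ> chart_inv c) y) < \<epsilon>}
        | g c K m \<epsilon>. g \<in> smooth_functions A \<and> c \<in> A \<and> compact K \<and> K \<subseteq> snd c ` fst c \<and> \<epsilon> > 0}"
      unfolding O'_def by blast
  qed
  then have op: "openin (quasi_norm_topology V N) {h \<in> topspace (quasi_norm_topology V N). h \<in> O'}"
    using inclusion openin_continuous_map_preimage by blast
  have "openin (quasi_norm_topology V N) V"
    unfolding openin_quasi_norm_topology by (auto intro: exI[of _ 1])
  then have "0 \<in> {h \<in> topspace (quasi_norm_topology V N). h \<in> O'}"
  proof -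
    have "\<phi> 0 = 0"
      using lin zero unfolding linear_functional_on_def by (metis add_cancel_right_right add.right_neutral)
    then have "0 \<in> O'" using zero V by (auto simp: O'_def \<phi>_def)
    then show ?thesis using zero \<open>openin (quasi_norm_topology V N) V\<close> openin_subset by fastforce
  qed
  then obtain \<epsilon> where \<epsilon>: "\<epsilon> > 0" "\<And>w. w \<in> V \<Longrightarrow> N (w - 0) < \<epsilon> \<Longrightarrow> w \<in> O'"
    using op unfolding openin_quasi_norm_topology by blast
  have small: "cmod (\<phi> w) < 1" if "w \<in> V" "N w < \<epsilon>" for w
    using \<epsilon>(2)[OF that(1)] that(2) by (auto simp: O'_def \<phi>_def)
  have hom: "\<phi> (\<lambda>x. a * h x) = a * \<phi> h" if "h \<in> V" for a h
    using lin that by (auto simp: linear_functional_on_def)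
  have "cmod (\<phi> h) \<le> 2 / \<epsilon> * N h" if h: "h \<in> V" for h
  proof (cases "N h = 0")
    case True
    then have "h = (\<lambda>x. 0 * h x)" using Q(4)[OF h] by auto
    then have "\<phi> h = 0" using hom[OF h, of 0] by simp
    then show ?thesis using True by simp
  next
    case False
    then have pos: "N h > 0" using Q(2)[OF h] by simp
    \<comment> \<open>Rescales \<open>h\<close> to quasi-norm \<epsilon>/2, strictly inside the
      ball.\<close>
    define t where "t = \<epsilon> / (2 * N h)"
    have t: "t > 0" using pos \<epsilon>(1) by (simp add: t_def)
    have "N (\<lambda>x. of_real t * h x) < \<epsilon>"
    proof -
      have "N (\<lambda>x. of_real t * h x) = t * N h" using Q(3)[OF h, of "of_real t"] t by simp
      also have "\<dots> = \<epsilon> / 2" using pos by (simp add: t_def)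
      finally show ?thesis using \<epsilon>(1) by simp
    qed
    from small[OF scale[OF h] this] have "t * cmod (\<phi> h) < 1"
      using hom[OF h] t by (simp add: norm_mult)
    then show ?thesis using pos \<epsilon>(1) by (simp add: t_def field_simps)
  qed
  then show ?thesis unfolding \<phi>_def by blast
qed

lemma point_ops_bounded_on:
  assumes A: "smooth_structure A" and c: "c \<in> charts_at A p"
    and qb: "quasi_banach_space V N" and V: "V \<subseteq> smooth_functions A"
    and inclusion: "continuous_map (quasi_norm_topology V N) (whitney_topology A) (\<lambda>h. h)"
    and u: "u \<in> point_ops A p c k"
  shows "\<exists>B. \<forall>h\<in>V. cmod (u h) \<le> B * N h"
proof -
  obtain D where D: "u = delta A p c D" using u by (auto simp: point_ops_def)
  have "\<exists>B. \<forall>m. \<forall>h\<in>V. cmod (multi_partial m (h \<circ> chart_inv c) (snd c p)) \<le> B m * N h"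
    using multi_partial_bounded_on[OF A c qb V inclusion] by metis
  then obtain B where B: "\<And>m h. h \<in> V \<Longrightarrow> cmod (multi_partial m (h \<circ> chart_inv c) (snd c p)) \<le> B m * N h"
    by blast
  have "cmod (u h) \<le> (\<Sum>m\<in>Poly_Mapping.keys D. cmod (Poly_Mapping.lookup D m) * B m) * N h"
    if h: "h \<in> V" for h
  proof -
    have "cmod (u h) \<le> (\<Sum>m\<in>Poly_Mapping.keys D.
        cmod (Poly_Mapping.lookup D m * multi_partial m (h \<circ> chart_inv c) (snd c p)))"
      using h V by (auto simp: D delta_def apply_diff_op_def intro: norm_sum)
    also have "\<dots> \<le> (\<Sum>m\<in>Poly_Mapping.keys D. cmod (Poly_Mapping.lookup D m) * (B m * N h))"
      unfolding norm_mult by (intro sum_mono mult_left_mono B h) auto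
    finally show ?thesis by (simp add: sum_distrib_left mult_ac)
  qed
  then show ?thesis by blast
qed

lemma bounded_composition_operator_funpow:
  assumes "bounded_composition_operator f V N" and N: "\<And>v. v \<in> V \<Longrightarrow> N v \<ge> 0"
  obtains C where "C \<ge> 1" "\<And>h m. h \<in> V \<Longrightarrow> h \<circ> (f ^^ m) \<in> V"
    "\<And>h m. h \<in> V \<Longrightarrow> N (h \<circ> (f ^^ m)) \<le> C ^ m * N h"
proof -
  obtain C where mem: "\<And>h. h \<in> V \<Longrightarrow> h \<circ> f \<in> V" and C: "\<And>h. h \<in> V \<Longrightarrow> N (h \<circ> f) \<le> C * N h"
    using assms(1) unfolding bounded_composition_operator_def by blast
  \<comment> \<open>The sign of the given \<open>C\<close> is unknown; a constant at least 1 allows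
    multiplying inequalities here and dividing by its powers later.\<close>
  define C' where "C' = \<bar>C\<bar> + 1"
  have C': "N (h \<circ> f) \<le> C' * N h" if "h \<in> V" for h
  proof -
    have "C * N h \<le> C' * N h" using N[OF that] by (intro mult_right_mono) (auto simp: C'_def)
    then show ?thesis using C[OF that] by linarith
  qed
  have *: "h \<circ> (f ^^ m) \<in> V \<and> N (h \<circ> (f ^^ m)) \<le> C' ^ m * N h" if h: "h \<in> V" for h m
  proof (induction m)
    case 0
    then show ?case using h by (simp add: id_def o_def)
  next
    case (Suc m)
    have eq: "h \<circ> (f ^^ Suc m) = (h \<circ> (f ^^ m)) \<circ> f" by (simp add: funpow_Suc_right o_assoc del: funpow.simps)
    have "N (h \<circ> (f ^^ Suc m)) \<le> C' * N (h \<circ> (f ^^ m))" unfolding eq using C' Suc by blast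
    also have "\<dots> \<le> C' * (C' ^ m * N h)"
      by (intro mult_left_mono conjunct2[OF Suc]) (simp add: C'_def)
    finally have "N (h \<circ> (f ^^ Suc m)) \<le> C' ^ Suc m * N h" by (simp only: power_Suc mult.assoc)
    then show ?case unfolding eq using mem Suc by blast
  qed
  have "C' \<ge> 1" by (simp add: C'_def)
  with * show ?thesis using that by blast
qed

subsection \<open>The graded kernels and the bound on eigenvalues\<close>

text \<open>On \<open>V\<close> the functional \<open>u\<close> cannot be told apart from the
  lower-order \<open>d\<close>, so its class restricts to zero. As the induced map is a union of
  cosets, this has to be shown as an equality of sets.\<close>

lemma ker_kappaI:
  assumes A: "smooth_structure A" and c: "c \<in> charts_at A p"
    and u: "u \<in> point_ops A p c (int n)"
    and d: "d \<in> point_ops A p c (int n - 1)" "\<And>h. h \<in> V \<Longrightarrow> u h = d h"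
  shows "u +o point_ops A p c (int n - 1) \<in> ker_kappa A V p c n"
proof -
  let ?D = "point_ops A p c (int n - 1)" and ?R = "restriction V"
  note sub = point_ops_subspace[OF A c, where n = n]
  have R_add: "?R (a + b) = ?R a + ?R b" for a b by (auto simp: dual_map_def)
  have R_u: "?R u = ?R d" using d(2) by (auto simp: dual_map_def)
  have "(\<Union>u'\<in>u +o ?D. ?R u' +o ?R ` ?D) = ?R ` ?D"
  proof (intro subset_antisym subsetI)
    fix y assume "y \<in> (\<Union>u'\<in>u +o ?D. ?R u' +o ?R ` ?D)"
    then obtain a b where "a \<in> ?D" "b \<in> ?D" "y = ?R (u + a) + ?R b"
      by (auto simp: elt_set_plus_def)
    then have "y = ?R (d + a + b)" "d + a + b \<in> ?D"
      using R_u R_add sub(2) d(1) by auto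
    then show "y \<in> ?R ` ?D" by blast
  next
    fix y assume "y \<in> ?R ` ?D"
    then obtain a where a: "a \<in> ?D" "y = ?R a" by blast
    \<comment> \<open>Since \<open>u\<close> and \<open>d\<close> have the same restriction,
      shifting by \<open>d\<close> places an arbitrary \<open>y\<close> in the coset of
      \<open>u\<close>.\<close>
    have "y = ?R (d + (a - d))" using a by simp
    also have "\<dots> = ?R (u + 0) + ?R (a - d)" unfolding R_add[of d] using R_u by simp
    finally have "y \<in> ?R (u + 0) +o ?R ` ?D"
      using sub(3)[OF a(1) d(1)] by (auto simp: elt_set_plus_def)
    moreover have "u + 0 \<in> u +o ?D" using sub(1) by (auto simp: elt_set_plus_def)
    ultimately show "y \<in> (\<Union>u'\<in>u +o ?D. ?R u' +o ?R ` ?D)" by blast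
  qed
  then show ?thesis
    using u by (auto simp: ker_kappa_def kappa_map_def induced_map_def quotient_space_def)
qed

text \<open>The coset of \<open>u\<close> contains \<open>u\<close>, and the coset of its image
  contains that image; both use that 0 lies in the lower-order space.\<close>

lemma ker_grD:
  assumes A: "smooth_structure A" and c: "c \<in> charts_at A p"
    and ker: "u +o point_ops A p c (int n - 1) \<in> ker_gr A g p c n"
  shows "pushforward A g u \<in> point_ops A p c (int n - 1)"
proof -
  let ?D = "point_ops A p c (int n - 1)"
  have zero: "0 \<in> ?D" using point_ops_subspace(1)[OF A c] .
  have "u + 0 \<in> u +o ?D" using zero by (auto simp: elt_set_plus_def)
  moreover have "pushforward A g u + 0 \<in> pushforward A g u +o ?D"
    using zero by (auto simp: elt_set_plus_def)
  ultimately have "pushforward A g u + 0 \<in> gr_map A g p c n (u +o ?D)"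
    unfolding gr_map_def induced_map_def by auto
  also have "\<dots> = ?D" using ker by (simp add: ker_gr_def)
  finally show ?thesis by simp
qed

theorem theorem1p1:
  fixes A :: "('x::{t2_space, second_countable_topology}, 'd::finite) chart set"
    and f :: "'x \<Rightarrow> 'x"
    and V :: "('x \<Rightarrow> complex) set"
    and N :: "('x \<Rightarrow> complex) \<Rightarrow> real"
    and p :: 'x and r :: nat
    and c :: "('x, 'd) chart"
    and \<alpha> :: complex
  assumes manifold: "smooth_structure A"
    and smooth: "smooth_map A f"
    and quasi_banach: "quasi_banach_space V N"
    and subspace: "V \<subseteq> smooth_functions A"
    and inclusion: "continuous_map (quasi_norm_topology V N) (whitney_topology A) (\<lambda>h. h)"
    and periodic: "r \<ge> 1" "(f ^^ r) p = p"
    and coordinate: "c \<in> charts_at A p"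
    and bounded: "bounded_composition_operator f V N"
    and kernels: "infinite {n. ker_kappa A V p c n \<subseteq> ker_gr A (f ^^ r) p c n}"
    and eigenvalue: "complex_eigenvalue (tangent_space A p) (differential A (f ^^ r) p) \<alpha>"
  shows "cmod \<alpha> \<le> 1"
proof (rule ccontr)
  assume "\<not> cmod \<alpha> \<le> 1"
  then have \<alpha>: "cmod \<alpha> > 1" "\<alpha> \<noteq> 0" by auto
  let ?g = "f ^^ r" and ?E = "smooth_functions A" and ?x0 = "snd c p"
  have g: "smooth_map A ?g" "?g p = p"
    using smooth_map_funpow[OF manifold smooth] periodic by auto
  obtain z i where zi: "z i \<noteq> 0" and eigen: "\<And>j. (\<Sum>i\<in>UNIV. z i * of_real
      (frechet_derivative (snd c \<circ> ?g \<circ> chart_inv c) (at ?x0) (axis i 1) $ j)) = \<alpha> * z j"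
    using complex_eigenvector_in_chart[OF manifold coordinate g eigenvalue] by blast
  note Q = quasi_banach_spaceD[OF quasi_banach]
  obtain C where C: "C \<ge> 1" "\<And>h m. h \<in> V \<Longrightarrow> h \<circ> (f ^^ m) \<in> V"
    "\<And>h m. h \<in> V \<Longrightarrow> N (h \<circ> (f ^^ m)) \<le> C ^ m * N h"
    using bounded_composition_operator_funpow[OF bounded Q(2)] by metis
  \<comment> \<open>\<open>C ^ r\<close> bounds composition with \<open>f ^^ r\<close>.\<close>
  obtain n0 where n0: "C ^ r < cmod \<alpha> ^ n0" using real_arch_pow[OF \<alpha>(1)] by blast
  obtain n where n: "n \<ge> n0" "ker_kappa A V p c n \<subseteq> ker_gr A ?g p c n"
    using kernels unfolding infinite_nat_iff_unbounded_le by blast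
  have large: "C ^ r < cmod \<alpha> ^ n"
    using n0 power_increasing[OF n(1), of "cmod \<alpha>"] \<alpha>(1) by linarith

  note ch = charts_atD[OF manifold coordinate]
  \<comment> \<open>The default 0 matches the convention for functionals in
    \<open>point_ops\<close>.\<close>
  define u where "u h = (if h \<in> ?E then (complex_derivative z ^^ n) (h \<circ> chart_inv c) ?x0 else 0)" for h
  define flat where "flat h \<longleftrightarrow> vanishes_to_order n (h \<circ> chart_inv c) ?x0" for h
  have u_compose: "flat (h \<circ> ?g)" "u (h \<circ> ?g) = \<alpha> ^ n * u h" if "h \<in> ?E" "flat h" for h
    using that vanishes_to_order_compose_map[OF manifold coordinate g]
      smooth_functions_compose[OF manifold g(1)]
      funpow_complex_derivative_compose_map[OF manifold coordinate g _ _ eigen]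
    by (auto simp: u_def flat_def)
  have u_mem: "u \<in> point_ops A p c (int n)"
  proof -
    \<comment> \<open>Order n is rewritten to fit the annihilator criterion, which then asks for
      vanishing to order \<open>Suc n\<close>.\<close>
    have "u \<in> point_ops A p c (int (Suc n) - 1)"
      unfolding point_ops_iff[OF manifold coordinate] linear_functional_on_def
    proof (intro conjI ballI allI impI)
      note E = function_space_smooth_functions[OF manifold, unfolded function_space_def]
      note sm = smooth_functions_chart[OF _ ch(1)]
      fix v w a assume v: "v \<in> ?E"
      show "u (v + w) = u v + u w" if "w \<in> ?E"
        using E v that funpow_complex_derivative_add[OF ch(4,5) sm[OF v] sm[OF that]]
        by (simp add: u_def plus_comp)
      show "u (\<lambda>x. a * v x) = a * u v"
        using E v funpow_complex_derivative_cmult[OF ch(4,5) sm[OF v]]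
        by (simp add: u_def cmult_comp)
      show "u v = 0" if "vanishes_to_order (Suc n) (v \<circ> chart_inv c) ?x0"
        using funpow_complex_derivative_eq_0[OF ch(4,5) sm[OF v] that] by (simp add: u_def)
    qed (simp add: u_def)
    then show ?thesis by simp
  qed

  have "\<exists>h\<in>V. flat h \<and> u h \<noteq> 0"
  proof (rule ccontr)
    assume contra: "\<not> ?thesis"
    have "linear_functional_on V u"
      by (rule linear_functional_on_subset[OF point_ops_linear(1)[OF manifold coordinate u_mem] subspace])
    then obtain d where "d \<in> point_ops A p c (int n - 1)" "\<And>h. h \<in> V \<Longrightarrow> u h = d h"
      using functional_in_restriction_point_ops[OF manifold coordinate Q(1) subspace, of u n] contra
      by (auto simp: flat_def)
    then have "u +o point_ops A p c (int n - 1) \<in> ker_gr A ?g p c n"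
      using ker_kappaI[OF manifold coordinate u_mem] n(2) by blast
    then have F: "pushforward A ?g u \<in> point_ops A p c (int n - 1)"
      by (rule ker_grD[OF manifold coordinate])
    \<comment> \<open>This \<open>h\<close> is merely smooth and need not lie in \<open>V\<close>:
      the order of the pushforward is tested on all smooth functions. The contradiction follows from
      \<open>\<alpha> \<noteq> 0\<close>.\<close>
    obtain h where h: "h \<in> ?E" "flat h" "u h \<noteq> 0"
      using test_function_exists[where z = z and i = i and n = n, OF manifold coordinate zi] by (auto simp: flat_def u_def)
    have "pushforward A ?g u h = 0"
      using point_ops_vanish[OF manifold coordinate F h(1)] h(2) by (simp add: flat_def)
    then show False
      using u_compose(2)[OF h(1,2)] h \<alpha>(2) by (simp add: pushforward_def dual_map_def)
  qed
  then obtain h where h: "h \<in> V" "flat h" "u h \<noteq> 0" by blast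

  \<comment> \<open>Flatness is carried along because \<open>u\<close> scales by
    \<open>\<alpha> ^ n\<close> on flat functions only.\<close>
  have iterate: "flat (h \<circ> (f ^^ (r * m))) \<and> u (h \<circ> (f ^^ (r * m))) = (\<alpha> ^ n) ^ m * u h" for m
  proof (induction m)
    case 0
    then show ?case using h(2) by (simp add: id_def o_def)
  next
    case (Suc m)
    let ?hm = "h \<circ> (f ^^ (r * m))"
    have eq: "h \<circ> (f ^^ (r * Suc m)) = ?hm \<circ> ?g"
      by (simp add: funpow_add add.commute[of r] o_assoc)
    have mem: "?hm \<in> ?E" using C(2)[OF h(1)] subspace by blast
    have "u (?hm \<circ> ?g) = (\<alpha> ^ n) ^ Suc m * u h"
      using u_compose(2)[OF mem] Suc by (simp only: power_Suc mult.assoc)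
    then show ?case unfolding eq using u_compose(1)[OF mem] Suc by blast
  qed
  obtain B where B: "\<And>h. h \<in> V \<Longrightarrow> cmod (u h) \<le> B * N h"
    using point_ops_bounded_on[OF manifold coordinate quasi_banach subspace inclusion u_mem] by blast
  \<comment> \<open>The bound is independent of \<open>m\<close>, while the ratio exceeds 1 by the
    choice of n, so its powers are unbounded.\<close>
  have "cmod (u h) * (cmod \<alpha> ^ n / C ^ r) ^ m \<le> \<bar>B\<bar> * N h" for m
  proof -
    let ?hm = "h \<circ> (f ^^ (r * m))"
    have "cmod (u h) * (cmod \<alpha> ^ n) ^ m = cmod (u ?hm)"
      using iterate[of m] by (simp add: norm_mult norm_power)
    also have "\<dots> \<le> B * N ?hm" by (rule B[OF C(2)[OF h(1)]])
    also have "\<dots> \<le> \<bar>B\<bar> * N ?hm" using Q(2)[OF C(2)[OF h(1)]] by (intro mult_right_mono) auto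
    also have "\<dots> \<le> \<bar>B\<bar> * (C ^ (r * m) * N h)" by (intro mult_left_mono C(3) h(1)) auto
    finally have "cmod (u h) * (cmod \<alpha> ^ n) ^ m \<le> \<bar>B\<bar> * ((C ^ r) ^ m * N h)"
      by (simp only: power_mult[of C])
    then show ?thesis
      using C(1) by (simp add: power_divide divide_le_eq mult_ac)
  qed
  moreover obtain m where "\<bar>B\<bar> * N h / cmod (u h) < (cmod \<alpha> ^ n / C ^ r) ^ m"
    using real_arch_pow[of "cmod \<alpha> ^ n / C ^ r"] large C(1) by (auto simp: less_divide_eq)
  ultimately show False
    using h(3) by (simp add: divide_less_eq mult.commute not_less[symmetric])
qed

end
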